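(* Let $K\subset\mathbb{R}$ be a field, let $\mathbf{g}=\{g_1,\dots,g_r\}$ and $\mathbf{h}=\{h_1,\dots,h_s\}$ be two finite sets of polynomials in $K[\mathbf{x}]=K[x_1,\dots,x_n]$ such that the ideal $I=(\mathbf{h})\subset K[\mathbf{x}]$ is zero-dimensional, let $B$ be a monomial basis of $K[\mathbf{x}]/I$ with $|B|=D$, and let $$S=\{\xi\in\mathbb{R}^n : g_i(\xi)\ge 0 \text{ for } 1\le i\le r \text{ and } h_j(\xi)=0 \text{ for } 1\le j\le s\}.$$ If $f\in K[\mathbf{x}]$ is such that $f>0$ on $S$, or such that $f\ge 0$ on $S$ and $(I:f)+(f)=(1)$, then there exist $\omega_{i,k}\in K_{\ge 0}$ and $q_{i,k}\in\langle B\rangle_K$ for $0\le i\le r$, $1\le k\le D$, and $p_j\in K[\mathbf{x}]$ for $1\le j\le s$, such that $$f=\sum_{k=1}^D\omega_{0,k}\,q_{0,k}^2+\sum_{i=1}^r\Big(\sum_{k=1}^D\omega_{i,k}\,q_{i,k}^2\Big)g_i+\sum_{j=1}^s p_j h_j .$$ Furthermore, if $\mathbf{h}$ is a graded basis of $I$ and $\deg(B)$ is an upper bound for the maximum degree of a monomial in $B$, then the elements $\omega_{i,k}\in K_{\ge 0}$, $q_{i,k}\in\langle B\rangle_K$ ($0\le i\le r$, $1\le k\le D$) and $p_j\in K[\mathbf{x}]$ ($1\le j\le s$) satisfying $$f=\sum_{k=1}^D\omega_{0,k}\,q_{0,k}^2+\sum_{i=1}^r\Big(\sum_{k=1}^D\omega_{i,k}\,q_{i,k}^2\Big)g_i+\sum_{j=1}^s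 p_j h_j$$ can be chosen so that, for all $1\le j\le s$, $$\deg(p_jh_j)\le\max\{\deg(f),\ \deg(g_i)+2\deg(B) : 0\le i\le r\},\qquad\text{where } g_0:=1 .$$
   Context: An ideal $I=(h_1,\dots,h_s)\subset K[\mathbf{x}]$ is zero-dimensional if its set of common zeros in $\mathbb{C}^n$ is finite, equivalently if $K[\mathbf{x}]/I$ is a finite-dimensional $K$-vector space. A monomial basis $B$ of $K[\mathbf{x}]/I$ is a set of monomials whose classes form a $K$-basis of $K[\mathbf{x}]/I$; $\langle B\rangle_K\subset K[\mathbf{x}]$ is the $K$-vector space spanned by $B$. $K_{\ge0}=\{\omega\in K:\omega\ge0\}$. The colon ideal is $(I:f)=\{h\in K[\mathbf{x}]: fh\in I\}$. The set $\mathbf{h}$ is a graded basis of $I$ if every $p\in I$ can be written $p=\sum_{j=1}^s p_jh_j$ with $p_j\in K[\mathbf{x}]$ and $\deg(p_j)\le\deg(p)-\deg(h_j)$ for all $j$. *)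

theory Defs
  imports "HOL-Analysis.Analysis" "HOL-Library.Poly_Mapping"
begin

text \<open>
  Polynomials in variables indexed by a finite type \<open>'n\<close>, with \<open>n = CARD('n)\<close>, are finitely
  supported maps from exponent vectors to real coefficients.  For a subfield \<open>K\<close> of the reals,
  \<open>K[x]\<close> is the set of those polynomials all of whose coefficients lie in \<open>K\<close>.
\<close>

type_synonym 'n monomial = "'n \<Rightarrow>\<^sub>0 nat"
type_synonym 'n mpoly = "'n monomial \<Rightarrow>\<^sub>0 real"

definition subfield_real :: "real set \<Rightarrow> bool" where
  "subfield_real K \<longleftrightarrow> 0 \<in> K \<and> 1 \<in> K \<and>
     (\<forall>a\<in>K. \<forall>b\<in>K. a + b \<in> K \<and> a * b \<in> K) \<and> (\<forall>a\<in>K. - a \<in> K \<and> inverse a \<in> K)"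

definition nonneg_elems :: "real set \<Rightarrow> real set" where
  "nonneg_elems K = {\<omega> \<in> K. \<omega> \<ge> 0}"

definition polys :: "real set \<Rightarrow> 'n mpoly set" where
  "polys K = {p. \<forall>m. Poly_Mapping.lookup p m \<in> K}"

definition const :: "real \<Rightarrow> 'n mpoly" where
  "const c = Poly_Mapping.single 0 c"

text \<open>
  Evaluation is used both at real points (where \<open>of_real\<close> is the identity) and at complex points.
\<close>

definition eval :: "'n::finite mpoly \<Rightarrow> 'a::real_normed_field ^ 'n \<Rightarrow> 'a" where
  "eval p \<xi> = (\<Sum>m\<in>Poly_Mapping.keys p.
     of_real (Poly_Mapping.lookup p m) * (\<Prod>i\<in>UNIV. (\<xi> $ i) ^ Poly_Mapping.lookup m i))"

definition monomial_deg :: "'n::finite monomial \<Rightarrow> nat" where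
  "monomial_deg m = (\<Sum>i\<in>UNIV. Poly_Mapping.lookup m i)"

text \<open>Total degree, with the zero polynomial sent to 0 instead of minus infinity.\<close>

definition deg :: "'n::finite mpoly \<Rightarrow> nat" where
  "deg p = (if p = 0 then 0 else Max (monomial_deg ` Poly_Mapping.keys p))"

definition ideal_gen :: "real set \<Rightarrow> 'n mpoly set \<Rightarrow> 'n mpoly set" where
  "ideal_gen K H = {\<Sum>u\<in>F. a u * u | a F. finite F \<and> F \<subseteq> H \<and> (\<forall>u\<in>F. a u \<in> polys K)}"

definition ideal_sum :: "'n mpoly set \<Rightarrow> 'n mpoly set \<Rightarrow> 'n mpoly set" where
  "ideal_sum I J = {a + b | a b. a \<in> I \<and> b \<in> J}"

definition colon_ideal :: "real set \<Rightarrow> 'n mpoly set \<Rightarrow> 'n mpoly \<Rightarrow> 'n mpoly set" where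
  "colon_ideal K I f = {u \<in> polys K. f * u \<in> I}"

definition zero_dimensional :: "'n::finite mpoly set \<Rightarrow> bool" where
  "zero_dimensional I \<longleftrightarrow> finite {\<xi> :: complex ^ 'n. \<forall>p\<in>I. eval p \<xi> = 0}"

definition mono_span :: "real set \<Rightarrow> 'n monomial set \<Rightarrow> 'n mpoly set" where
  "mono_span K B = {\<Sum>m\<in>F. Poly_Mapping.single m (c m) | c F.
     finite F \<and> F \<subseteq> B \<and> (\<forall>m\<in>F. c m \<in> K)}"

text \<open>
  The two conjuncts say that the classes modulo \<open>I\<close> of the monomials in \<open>B\<close> are linearly
  independent over \<open>K\<close> (in particular pairwise distinct), and that they span \<open>K[x]/I\<close>.
\<close>

definition monomial_basis :: "real set \<Rightarrow> 'n mpoly set \<Rightarrow> 'n monomial set \<Rightarrow> bool" where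
  "monomial_basis K I B \<longleftrightarrow>
     (\<forall>F c. finite F \<longrightarrow> F \<subseteq> B \<longrightarrow> (\<forall>m\<in>F. c m \<in> K) \<longrightarrow>
        (\<Sum>m\<in>F. Poly_Mapping.single m (c m)) \<in> I \<longrightarrow> (\<forall>m\<in>F. c m = 0)) \<and>
     (\<forall>p\<in>polys K. \<exists>q\<in>mono_span K B. p - q \<in> I)"

text \<open>
  The bound \<open>deg (a j) \<le> deg p - deg (h j)\<close> is stated additively.  It holds vacuously when
  \<open>a j\<close> or \<open>h j\<close> is zero, as it does for the convention that zero has degree minus infinity;
  for \<open>p = 0\<close> the choice \<open>a = 0\<close> is available.
\<close>

definition graded_basis ::
  "real set \<Rightarrow> nat \<Rightarrow> (nat \<Rightarrow> 'n::finite mpoly) \<Rightarrow> 'n mpoly set \<Rightarrow> bool" where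
  "graded_basis K s h I \<longleftrightarrow>
     (\<forall>p\<in>I. \<exists>a. (\<forall>j\<in>{1..s}. a j \<in> polys K) \<and> p = (\<Sum>j=1..s. a j * h j) \<and>
        (\<forall>j\<in>{1..s}. a j = 0 \<or> h j = 0 \<or> deg (a j) + deg (h j) \<le> deg p))"

definition semialg_set ::
  "nat \<Rightarrow> nat \<Rightarrow> (nat \<Rightarrow> 'n::finite mpoly) \<Rightarrow> (nat \<Rightarrow> 'n mpoly) \<Rightarrow> (real ^ 'n) set" where
  "semialg_set r s g h =
     {\<xi>. (\<forall>i\<in>{1..r}. eval (g i) \<xi> \<ge> 0) \<and> (\<forall>j\<in>{1..s}. eval (h j) \<xi> = 0)}"

definition sos_representation ::
  "real set \<Rightarrow> 'n monomial set \<Rightarrow> nat \<Rightarrow> nat \<Rightarrow> nat \<Rightarrow> (nat \<Rightarrow> 'n mpoly) \<Rightarrow> (nat \<Rightarrow> 'n mpoly) \<Rightarrow>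
   'n mpoly \<Rightarrow> (nat \<Rightarrow> nat \<Rightarrow> real) \<Rightarrow> (nat \<Rightarrow> nat \<Rightarrow> 'n mpoly) \<Rightarrow> (nat \<Rightarrow> 'n mpoly) \<Rightarrow> bool" where
  "sos_representation K B D r s g h f \<omega> q p \<longleftrightarrow>
     (\<forall>i\<in>{0..r}. \<forall>k\<in>{1..D}. \<omega> i k \<in> nonneg_elems K \<and> q i k \<in> mono_span K B) \<and>
     (\<forall>j\<in>{1..s}. p j \<in> polys K) \<and>
     f = (\<Sum>k=1..D. const (\<omega> 0 k) * (q 0 k)\<^sup>2)
       + (\<Sum>i=1..r. (\<Sum>k=1..D. const (\<omega> i k) * (q i k)\<^sup>2) * g i)
       + (\<Sum>j=1..s. p j * h j)"

end

theory Submission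
  imports Defs
begin

text \<open>
  Work modulo \<open>I\<close>.  Let \<open>\<Sigma>\<close> be the set of sums of squares of polynomials over \<open>K\<close> with weights in
  \<open>K\<^sub>\<ge>\<^sub>0\<close>, enlarged by \<open>I\<close>, and let \<open>M\<close> be the quadratic module \<open>\<Sigma> + \<Sigma> g\<^sub>1 + \<dots> + \<Sigma> g\<^sub>r\<close>.  The
  theorem says that \<open>f\<close> lies in \<open>M\<close>, together with a bound on the number of squares and on the
  degrees.

  The finite dimension of \<open>K[x]/I\<close> enters through the fact that \<open>\<Sigma>\<close> is archimedean: every \<open>p\<close> is
  bounded by a constant \<open>k\<close>, in the sense that \<open>k - p \<in> \<Sigma>\<close>.  Write \<open>a \<le> b\<close> for \<open>b - a \<in> \<Sigma>\<close> and let
  \<open>W\<close> be the sum of the squares of the basis monomials.  Cauchy-Schwarz bounds every square by a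
  multiple of \<open>W\<close>.  Applied to \<open>W\<close> itself it gives \<open>W\<^sup>2 \<le> k W\<close>, whence \<open>W \<le> k\<close>, so every square
  is bounded by a constant (\<open>archimedean_if_finite_dim_mod_ideal\<close>).

  An archimedean module contains every element that is positive under all real characters which
  are nonnegative on the module (\<open>archimedean_representation\<close>).  Indeed, if \<open>f \<notin> M\<close>, then
  \<open>M - \<Sigma> f\<close> does not contain \<open>- 1\<close>, hence it lies in a maximal module with this property; such a
  module \<open>Q\<close> satisfies \<open>Q \<union> - Q = K[x]\<close>, and the cut that it defines on the constants is a character
  with a value at most zero at \<open>f\<close>.  A character that is nonnegative on \<open>M\<close> vanishes on \<open>I\<close> and is
  the evaluation at a point of \<open>S\<close>.  All weights stay in \<open>K\<close> throughout, so no descent from the real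
  numbers to \<open>K\<close> has to be made.

  If \<open>f\<close> is only nonnegative on \<open>S\<close> and \<open>(I:f) + (f) = (1)\<close>, there is \<open>v\<close> with \<open>f \<equiv> v f\<^sup>2\<close> modulo \<open>I\<close>.
  Then \<open>e = v f\<close> is an idempotent which is \<open>1\<close> where \<open>f\<close> does not vanish and \<open>0\<close> where it does;
  \<open>f + (1 - e)\<close> is positive on \<open>S\<close>, and multiplying it by the square \<open>e\<^sup>2\<close> gives back \<open>f\<close>
  (\<open>archimedean_representation_nonneg\<close>).

  Finally each multiplier is reduced to the span of \<open>B\<close> and diagonalised as a quadratic form in the
  monomials of \<open>B\<close> by completing squares, which leaves at most one square for each element of \<open>B\<close>
  (\<open>wsos_lin_representation\<close>).  The remainder lies in \<open>I\<close> and has degree at most the maximum of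
  \<open>deg f\<close> and the numbers \<open>deg g\<^sub>i + 2 d\<close>, so a graded basis expresses it with the required degrees.
\<close>

section \<open>Algebras over a subfield of the reals\<close>

lemma subfield_real_closed:
  assumes K: "subfield_real K"
  shows "0 \<in> K" "1 \<in> K" "a \<in> K \<Longrightarrow> b \<in> K \<Longrightarrow> a + b \<in> K" "a \<in> K \<Longrightarrow> b \<in> K \<Longrightarrow> a * b \<in> K"
    "a \<in> K \<Longrightarrow> - a \<in> K" "a \<in> K \<Longrightarrow> inverse a \<in> K" "a \<in> K \<Longrightarrow> b \<in> K \<Longrightarrow> a - b \<in> K"
    "a \<in> K \<Longrightarrow> b \<in> K \<Longrightarrow> a / b \<in> K" "a \<in> K \<Longrightarrow> a ^ n \<in> K"
proof -
  show "0 \<in> K" "1 \<in> K" "a \<in> K \<Longrightarrow> b \<in> K \<Longrightarrow> a + b \<in> K" "a \<in> K \<Longrightarrow> b \<in> K \<Longrightarrow> a * b \<in> K"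
    "a \<in> K \<Longrightarrow> - a \<in> K" "a \<in> K \<Longrightarrow> inverse a \<in> K"
    using K unfolding subfield_real_def by blast+
  show "a \<in> K \<Longrightarrow> b \<in> K \<Longrightarrow> a - b \<in> K"
    using K unfolding subfield_real_def by (metis diff_conv_add_uminus)
  show "a \<in> K \<Longrightarrow> b \<in> K \<Longrightarrow> a / b \<in> K"
    using K unfolding subfield_real_def by (metis divide_inverse)
  show "a \<in> K \<Longrightarrow> a ^ n \<in> K"
    using K by (induction n) (auto simp: subfield_real_def)
qed

lemma subfield_real_of_nat: "subfield_real K \<Longrightarrow> of_nat n \<in> K"
  by (induction n) (auto intro: subfield_real_closed)

lemma subfield_real_numeral: "subfield_real K \<Longrightarrow> numeral n \<in> K"
  using subfield_real_of_nat[of K "numeral n"] by simp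

lemma subfield_real_dense:
  assumes "subfield_real K" "a < b"
  obtains k where "k \<in> K" "a < k" "k < b"
proof -
  obtain q where q: "q \<in> \<rat>" "a < q" "q < b"
    using Rats_dense_in_real[OF assms(2)] by auto
  then obtain m n :: int where "q = of_int m / of_int n"
    by (auto elim!: Rats_cases')
  moreover have "of_int z \<in> K" for z
    by (cases z rule: int_cases)
       (auto simp del: of_nat_Suc intro: subfield_real_closed subfield_real_of_nat assms)
  ultimately show ?thesis
    using q that by (metis subfield_real_closed(8) assms(1))
qed

text \<open>
  This diagonalises a form \<open>v (b y + q)\<^sup>2 + w (y + l)\<^sup>2\<close> with respect to \<open>y\<close>: the first square on the
  right absorbs all terms that contain \<open>y\<close>, and Lagrange's identity for two weighted squares turns
  what is left into a single square.
\<close>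

lemma weighted_lagrange_identity: fixes w :: "'a::comm_ring_1" assumes tu: "t * u = 1" and t: "t = w + v * b\<^sup>2"
shows "v * (b * y + q)\<^sup>2 + w * (y + l)\<^sup>2 = t * (y + u * (w * l + v * b * q))\<^sup>2 + w * v * u * (q + - b * l)\<^sup>2"
proof -
  define A where "A = w * l + v * b * q"
  have "A\<^sup>2 + w * v * (q + - b * l)\<^sup>2 = t * (w * l\<^sup>2 + v * q\<^sup>2)"
    unfolding t A_def by (simp add: power2_eq_square algebra_simps)
  then have "u * (A\<^sup>2 + w * v * (q + - b * l)\<^sup>2) = (t * u) * (w * l\<^sup>2 + v * q\<^sup>2)"
    by (simp add: mult.commute mult.left_commute)
  then have *: "u * A\<^sup>2 + w * v * u * (q + - b * l)\<^sup>2 = w * l\<^sup>2 + v * q\<^sup>2"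
    unfolding tu by (simp add: distrib_left ac_simps)
  have "t * (y + u * A)\<^sup>2 = t * y\<^sup>2 + 2 * (t * u) * y * A + (t * u) * (u * A\<^sup>2)"
    by (simp add: power2_eq_square algebra_simps)
  then have "t * (y + u * A)\<^sup>2 + w * v * u * (q + - b * l)\<^sup>2 = t * y\<^sup>2 + 2 * y * A + (w * l\<^sup>2 + v * q\<^sup>2)"
    unfolding tu *[symmetric] by simp
  then show ?thesis unfolding A_def t by (simp add: power2_eq_square algebra_simps)
qed

text \<open>
  The function \<open>c\<close> embeds the scalars.  It is a ring homomorphism on all of the reals, which spares
  side conditions, but only scalars in \<open>K\<close> are required to land in the subring \<open>P\<close>.
\<close>

locale subfield_algebra =
  fixes K :: "real set" and c :: "real \<Rightarrow> 'a::comm_ring_1" and P :: "'a set"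
  assumes K: "subfield_real K"
    and c_one: "c 1 = 1"
    and c_add: "c (a + b) = c a + c b"
    and c_mult: "c (a * b) = c a * c b"
    and c_P: "k \<in> K \<Longrightarrow> c k \<in> P"
    and P_add: "p \<in> P \<Longrightarrow> q \<in> P \<Longrightarrow> p + q \<in> P"
    and P_mult: "p \<in> P \<Longrightarrow> q \<in> P \<Longrightarrow> p * q \<in> P"
begin

lemmas K_closed = subfield_real_closed[OF K] subfield_real_of_nat[OF K] subfield_real_numeral[OF K]

lemma c_zero: "c 0 = 0"
  using c_add[of 0 0] by simp

lemma c_minus: "c (- a) = - c a"
  using c_add[of a "- a"] by (simp add: c_zero eq_neg_iff_add_eq_0 add.commute)

lemma c_diff: "c (a - b) = c a - c b"
  using c_add[of a "- b"] by (simp add: c_minus)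

lemma c_numeral: "c (numeral n) = numeral n"
proof -
  have "c (of_nat m) = of_nat m" for m
    by (induction m) (auto simp: c_zero c_add c_one)
  from this[of "numeral n"] show ?thesis by simp
qed

lemma c_power: "c (a ^ n) = c a ^ n"
  by (induction n) (auto simp: c_one c_mult)

lemmas c_simps = c_zero c_one c_add c_mult c_minus c_diff c_numeral c_power

lemma c_inverse: "a \<noteq> 0 \<Longrightarrow> c a * c (inverse a) = 1"
  by (metis c_mult c_one right_inverse)

lemma P_uminus: "p \<in> P \<Longrightarrow> - p \<in> P"
  using P_mult[of "c (- 1)" p] c_P[of "- 1"] by (auto simp: c_simps intro: K_closed)

lemma P_diff: "p \<in> P \<Longrightarrow> q \<in> P \<Longrightarrow> p - q \<in> P"
  using P_add[of p "- q"] P_uminus[of q] by simp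

lemma P_zero: "0 \<in> P" and P_one: "1 \<in> P"
  using c_P[of 0] c_P[of 1] by (auto simp: c_simps intro: K_closed)

lemma P_sum: "(\<And>x. x \<in> A \<Longrightarrow> p x \<in> P) \<Longrightarrow> sum p A \<in> P"
  by (induction A rule: infinite_finite_induct) (auto intro: P_zero P_add)

lemma P_power: "p \<in> P \<Longrightarrow> p ^ n \<in> P"
  by (induction n) (auto intro: P_one P_mult)

lemmas P_closed = P_add P_mult P_uminus P_diff P_zero P_one P_sum P_power c_P

definition ideal :: "'a set \<Rightarrow> bool" where
  "ideal J \<longleftrightarrow> J \<subseteq> P \<and> 0 \<in> J \<and> (\<forall>i\<in>J. \<forall>j\<in>J. i + j \<in> J) \<and> (\<forall>p\<in>P. \<forall>i\<in>J. p * i \<in> J)"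

lemma idealD:
  assumes "ideal J"
  shows "J \<subseteq> P" "i \<in> J \<Longrightarrow> j \<in> J \<Longrightarrow> i + j \<in> J" "p \<in> P \<Longrightarrow> i \<in> J \<Longrightarrow> p * i \<in> J" "0 \<in> J"
    "(\<And>x. x \<in> A \<Longrightarrow> t x \<in> J) \<Longrightarrow> sum t A \<in> J"
proof -
  show *: "J \<subseteq> P" "i \<in> J \<Longrightarrow> j \<in> J \<Longrightarrow> i + j \<in> J" "p \<in> P \<Longrightarrow> i \<in> J \<Longrightarrow> p * i \<in> J" "0 \<in> J" for i j p
    using assms by (auto simp: ideal_def)
  show "(\<And>x. x \<in> A \<Longrightarrow> t x \<in> J) \<Longrightarrow> sum t A \<in> J"
    by (induction A rule: infinite_finite_induct) (auto intro: *)
qed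

text \<open>
  The values on scalars are part of the notion: a ring homomorphism into the reals need not respect
  the inclusion of \<open>K\<close>.
\<close>

definition real_character :: "('a \<Rightarrow> real) \<Rightarrow> bool" where
  "real_character \<phi> \<longleftrightarrow> (\<forall>k\<in>K. \<phi> (c k) = k) \<and>
     (\<forall>a\<in>P. \<forall>b\<in>P. \<phi> (a + b) = \<phi> a + \<phi> b \<and> \<phi> (a * b) = \<phi> a * \<phi> b)"

lemma real_characterD:
  assumes "real_character \<phi>"
  shows "k \<in> K \<Longrightarrow> \<phi> (c k) = k" "a \<in> P \<Longrightarrow> b \<in> P \<Longrightarrow> \<phi> (a + b) = \<phi> a + \<phi> b"
    "a \<in> P \<Longrightarrow> b \<in> P \<Longrightarrow> \<phi> (a * b) = \<phi> a * \<phi> b" "a \<in> P \<Longrightarrow> \<phi> (- a) = - \<phi> a"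
    "a \<in> P \<Longrightarrow> b \<in> P \<Longrightarrow> \<phi> (a - b) = \<phi> a - \<phi> b" "\<phi> 1 = 1" "\<phi> 0 = 0"
    "a \<in> P \<Longrightarrow> \<phi> (a ^ n) = \<phi> a ^ n"
proof -
  show 1: "k \<in> K \<Longrightarrow> \<phi> (c k) = k" and 2: "a \<in> P \<Longrightarrow> b \<in> P \<Longrightarrow> \<phi> (a + b) = \<phi> a + \<phi> b"
    and 3: "a \<in> P \<Longrightarrow> b \<in> P \<Longrightarrow> \<phi> (a * b) = \<phi> a * \<phi> b" for k a b
    using assms unfolding real_character_def by blast+
  show 6: "\<phi> 1 = 1" and 7: "\<phi> 0 = 0" using 1[of 1] 1[of 0] K_closed(1,2) by (auto simp: c_simps)
  show 4: "a \<in> P \<Longrightarrow> \<phi> (- a) = - \<phi> a" for a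
    using 2[of a "- a"] 7 P_uminus by simp
  show "a \<in> P \<Longrightarrow> b \<in> P \<Longrightarrow> \<phi> (a - b) = \<phi> a - \<phi> b"
    using 2[of a "- b"] 4[of b] P_uminus by simp
  show "a \<in> P \<Longrightarrow> \<phi> (a ^ n) = \<phi> a ^ n"
    by (induction n) (auto simp: 3 6 P_power)
qed

lemma real_character_sum:
  assumes "real_character \<phi>" "\<And>x. x \<in> A \<Longrightarrow> t x \<in> P"
  shows "\<phi> (sum t A) = (\<Sum>x\<in>A. \<phi> (t x))"
  using assms(2)
  by (induction A rule: infinite_finite_induct) (auto simp: real_characterD[OF assms(1)] P_sum)

lemma real_character_prod:
  assumes "real_character \<phi>" "\<And>x. x \<in> A \<Longrightarrow> t x \<in> P"
  shows "prod t A \<in> P \<and> \<phi> (prod t A) = (\<Prod>x\<in>A. \<phi> (t x))"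
  using assms(2)
  by (induction A rule: infinite_finite_induct)
     (auto simp: real_characterD[OF assms(1)] P_one intro: P_mult)

section \<open>Weighted sums of squares in a finite-dimensional space\<close>

inductive_set wsos :: "'a set \<Rightarrow> 'a set" for X where
  zero: "0 \<in> wsos X"
| add: "s \<in> wsos X \<Longrightarrow> w \<in> nonneg_elems K \<Longrightarrow> q \<in> X \<Longrightarrow> c w * q\<^sup>2 + s \<in> wsos X"

lemma wsos_add: "s \<in> wsos X \<Longrightarrow> t \<in> wsos X \<Longrightarrow> s + t \<in> wsos X"
  by (induction rule: wsos.induct) (auto intro: wsos.intros simp: add.assoc)

lemma wsos_term: "w \<in> nonneg_elems K \<Longrightarrow> q \<in> X \<Longrightarrow> c w * q\<^sup>2 \<in> wsos X"
  using wsos.add[OF wsos.zero] by fastforce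

lemma nonneg_elems_mult: "v \<in> nonneg_elems K \<Longrightarrow> w \<in> nonneg_elems K \<Longrightarrow> v * w \<in> nonneg_elems K"
  by (auto simp: nonneg_elems_def intro: K_closed)

lemma wsos_mult:
  assumes "s \<in> wsos P" "t \<in> wsos P"
  shows "s * t \<in> wsos P"
proof -
  have *: "c w * q\<^sup>2 * t \<in> wsos P" if "w \<in> nonneg_elems K" "q \<in> P" for w q
    using assms(2)
  proof (induction rule: wsos.induct)
    case zero
    then show ?case by (simp add: wsos.zero)
  next
    case (add s v r)
    have "c w * q\<^sup>2 * (c v * r\<^sup>2 + s) = c (w * v) * (q * r)\<^sup>2 + c w * q\<^sup>2 * s"
      by (simp add: c_mult power_mult_distrib algebra_simps)
    then show ?case
      using add that by (auto intro!: wsos.add nonneg_elems_mult P_mult)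
  qed
  from assms(1) show ?thesis
    by (induction rule: wsos.induct)
       (auto simp: distrib_right wsos.zero intro!: wsos_add *)
qed

lemma wsos_subset: "X \<subseteq> P \<Longrightarrow> s \<in> wsos X \<Longrightarrow> s \<in> P"
  by (erule wsos.induct) (auto simp: nonneg_elems_def intro!: P_closed)

text \<open>
  Squares are compatible with reduction because \<open>p\<^sup>2 - q\<^sup>2 = (p + q) (p - q)\<close>.
\<close>

lemma wsos_reduce_mod_ideal:
  assumes J: "ideal J" and X: "X \<subseteq> P" "\<And>p. p \<in> P \<Longrightarrow> \<exists>q\<in>X. p - q \<in> J"
    and s: "s \<in> wsos P"
  shows "\<exists>s'\<in>wsos X. s - s' \<in> J"
  using s
proof (induction rule: wsos.induct)
  case zero
  show ?case using wsos.zero idealD(4)[OF J] by force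
next
  case (add s w p)
  then obtain s' where s': "s' \<in> wsos X" "s - s' \<in> J" by blast
  obtain q where q: "q \<in> X" "p - q \<in> J" using X(2) add by blast
  have "c w * (p + q) \<in> P" using add q X(1) by (auto simp: nonneg_elems_def intro!: P_closed)
  then have "c w * (p + q) * (p - q) + (s - s') \<in> J" using idealD[OF J] q s' by blast
  moreover have "c w * (p + q) * (p - q) + (s - s') = (c w * p\<^sup>2 + s) - (c w * q\<^sup>2 + s')"
    by (simp add: power2_eq_square algebra_simps)
  ultimately show ?case using wsos.add[OF s'(1) add(2) q(1)] by metis
qed

definition lin :: "('b \<Rightarrow> 'a) \<Rightarrow> 'b set \<Rightarrow> 'a set" where
  "lin y B = {\<Sum>m\<in>B. c (e m) * y m | e. \<forall>m. e m \<in> K}"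

lemma lin_zero: "0 \<in> lin y B"
proof -
  have "0 = (\<Sum>m\<in>B. c 0 * y m)" by (simp add: c_zero)
  then show ?thesis unfolding lin_def by (force intro: K_closed)
qed

lemma lin_add:
  assumes "p \<in> lin y B" "q \<in> lin y B"
  shows "p + q \<in> lin y B"
proof -
  obtain e e' where "p = (\<Sum>m\<in>B. c (e m) * y m)" "\<forall>m. e m \<in> K"
    "q = (\<Sum>m\<in>B. c (e' m) * y m)" "\<forall>m. e' m \<in> K"
    using assms by (auto simp: lin_def)
  then have "p + q = (\<Sum>m\<in>B. c (e m + e' m) * y m)" "\<forall>m. e m + e' m \<in> K"
    by (auto simp: c_add distrib_right sum.distrib intro: K_closed)
  then show ?thesis unfolding lin_def by (intro CollectI exI[of _ "\<lambda>m. e m + e' m"]) simp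
qed

lemma lin_scale:
  assumes "p \<in> lin y B" "k \<in> K"
  shows "c k * p \<in> lin y B"
proof -
  obtain e where "p = (\<Sum>m\<in>B. c (e m) * y m)" "\<forall>m. e m \<in> K"
    using assms by (auto simp: lin_def)
  then have "c k * p = (\<Sum>m\<in>B. c (k * e m) * y m)" "\<forall>m. k * e m \<in> K"
    using assms(2) by (auto simp: c_mult mult.assoc sum_distrib_left intro: K_closed)
  then show ?thesis unfolding lin_def by (intro CollectI exI[of _ "\<lambda>m. k * e m"]) simp
qed

lemma lin_insert_cases:
  assumes "finite B" "b \<notin> B" "q \<in> lin y (insert b B)"
  obtains \<beta> q' where "\<beta> \<in> K" "q' \<in> lin y B" "q = c \<beta> * y b + q'"
proof -
  obtain e where "q = (\<Sum>m\<in>insert b B. c (e m) * y m)" "\<forall>m. e m \<in> K"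
    using assms(3) by (auto simp: lin_def)
  then show ?thesis
    using assms(1,2) that[of "e b" "\<Sum>m\<in>B. c (e m) * y m"] by (auto simp: lin_def)
qed

lemma lin_insertI:
  assumes "finite B" "b \<notin> B" "\<beta> \<in> K" "q' \<in> lin y B"
  shows "c \<beta> * y b + q' \<in> lin y (insert b B)"
proof -
  obtain e where e: "q' = (\<Sum>m\<in>B. c (e m) * y m)" "\<forall>m. e m \<in> K"
    using assms(4) by (auto simp: lin_def)
  have "c \<beta> * y b + q' = (\<Sum>m\<in>insert b B. c ((e(b := \<beta>)) m) * y m)"
    using assms(1,2) e(1) by (auto intro!: sum.cong)
  moreover have "\<forall>m. (e(b := \<beta>)) m \<in> K" using e assms(3) by auto
  ultimately show ?thesis unfolding lin_def by blast
qed

lemma lin_subset: "(\<And>m. m \<in> B \<Longrightarrow> y m \<in> P) \<Longrightarrow> lin y B \<subseteq> P"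
  by (auto simp: lin_def intro!: P_closed)

text \<open>
  Squares are absorbed one at a time.  Normalising the coefficient of \<open>y b\<close> in the distinguished square
  to one keeps the shape of the right-hand side stable under the induction, and a term without \<open>y b\<close> is
  recorded by the weight zero.
\<close>

lemma wsos_complete_square:
  assumes B: "finite B" "b \<notin> B" and s: "s \<in> wsos (lin y (insert b B))"
  shows "\<exists>w\<in>nonneg_elems K. \<exists>l\<in>lin y B. \<exists>s'\<in>wsos (lin y B). s = c w * (y b + l)\<^sup>2 + s'"
  using s
proof (induction rule: wsos.induct)
  case zero
  have "0 \<in> nonneg_elems K" by (auto simp: nonneg_elems_def intro: K_closed)
  moreover have "0 = c 0 * (y b + 0)\<^sup>2 + 0" by (simp add: c_zero)
  ultimately show ?case using lin_zero wsos.zero by blast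
next
  case (add s v q)
  then obtain w l s' where w: "w \<in> nonneg_elems K" "l \<in> lin y B" "s' \<in> wsos (lin y B)"
    "s = c w * (y b + l)\<^sup>2 + s'" by blast
  obtain \<beta> q' where q: "\<beta> \<in> K" "q' \<in> lin y B" "q = c \<beta> * y b + q'"
    using lin_insert_cases[OF B \<open>q \<in> lin y (insert b B)\<close>] .
  define t where "t = w + v * \<beta>\<^sup>2"
  have wv: "w \<ge> 0" "v \<ge> 0" "w \<in> K" "v \<in> K" using w add by (auto simp: nonneg_elems_def)
  have t: "t \<in> nonneg_elems K" using wv q by (auto simp: t_def nonneg_elems_def intro!: K_closed)
  show ?case
  proof (cases "t = 0")
    case True
    then have "w = 0" and v: "v = 0 \<or> \<beta> = 0"
      using wv by (auto simp: t_def add_nonneg_eq_0_iff)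
    have "c v * q\<^sup>2 = c v * q'\<^sup>2" using v by (auto simp: q c_zero)
    then have "c v * q\<^sup>2 + s = c t * (y b + l)\<^sup>2 + (c v * q'\<^sup>2 + s')"
      using \<open>w = 0\<close> True w(4) by (simp add: c_zero)
    moreover have "c v * q'\<^sup>2 + s' \<in> wsos (lin y B)"
      using w q add by (intro wsos.add)
    ultimately show ?thesis using t w(2) by blast
  next
    case False
    \<comment> \<open>Lagrange's identity for two squares: the part not involving \<open>y b\<close> is again a square.\<close>
    define u where "u = inverse t"
    define l' where "l' = c u * (c w * l + c (v * \<beta>) * q')"
    define r where "r = q' + c (- \<beta>) * l"
    have tu: "c t * c u = 1" using False c_inverse by (simp add: u_def)
    have ct: "c t = c w + c v * (c \<beta>)\<^sup>2" by (simp add: t_def c_simps)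
    have "c v * q\<^sup>2 + s = c t * (y b + l')\<^sup>2 + (c (w * v * u) * r\<^sup>2 + s')"
        unfolding w(4) q(3) l'_def r_def c_mult c_minus
      using weighted_lagrange_identity[OF tu ct, of "y b" q' l] by (simp add: add.assoc)
    moreover have "w * v * u \<in> nonneg_elems K"
      using wv t by (auto simp: u_def nonneg_elems_def intro!: K_closed mult_nonneg_nonneg)
    moreover have "l' \<in> lin y B" "r \<in> lin y B"
      using w q wv t unfolding l'_def r_def u_def nonneg_elems_def
      by (auto intro!: lin_add lin_scale K_closed)
    ultimately show ?thesis using t w(3) by (meson wsos.add)
  qed
qed

text \<open>
  Iterating the completion of squares removes one generator at a time and produces one square for each
  of them, so the number of squares is at most the dimension, however long the original sum.
\<close>

lemma wsos_lin_representation: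
  assumes "finite B" "s \<in> wsos (lin y B)"
  shows "\<exists>w q. (\<forall>m\<in>B. w m \<in> nonneg_elems K \<and> q m \<in> lin y B) \<and>
    s = (\<Sum>m\<in>B. c (w m) * (q m)\<^sup>2)"
  using assms
proof (induction B arbitrary: s)
  case empty
  have "s = 0" using empty
    by (induction rule: wsos.induct) (auto simp: lin_def)
  then show ?case by simp
next
  case (insert b B)
  obtain w l s' where w: "w \<in> nonneg_elems K" "l \<in> lin y B" "s' \<in> wsos (lin y B)"
    "s = c w * (y b + l)\<^sup>2 + s'"
    using wsos_complete_square[OF insert.hyps insert.prems] by blast
  obtain w' q' where q': "\<forall>m\<in>B. w' m \<in> nonneg_elems K \<and> q' m \<in> lin y B"
    "s' = (\<Sum>m\<in>B. c (w' m) * (q' m)\<^sup>2)"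
    using insert.IH[OF w(3)] by blast
  have ext: "1 \<in> K" "0 \<in> K" by (auto intro: K_closed)
  have "y b + l \<in> lin y (insert b B)"
    using lin_insertI[OF insert.hyps ext(1) w(2)] by (simp add: c_one)
  moreover have "q' m \<in> lin y (insert b B)" if "m \<in> B" for m
    using lin_insertI[OF insert.hyps ext(2), of "q' m" y] q' that by (simp add: c_zero)
  moreover have "s = (\<Sum>m\<in>insert b B. c ((w'(b := w)) m) * ((q'(b := y b + l)) m)\<^sup>2)"
    using insert.hyps w(4) q'(2) by (auto intro!: sum.cong)
  ultimately show ?case using q'(1) w(1) insert.hyps
    by (intro exI[of _ "w'(b := w)"] exI[of _ "q'(b := y b + l)"]) auto
qed

end

section \<open>Archimedean preorderings\<close>

text \<open>
  The elements of \<open>S\<close> play the role of the nonnegative ones; \<open>S \<inter> - S\<close> may be nonzero, so that an ideal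
  can be absorbed into \<open>S\<close> and no quotient ring has to be formed.
\<close>

locale preordered_algebra = subfield_algebra K c P for K c and P :: "'a::comm_ring_1 set" +
  fixes S :: "'a set"
  assumes S_P: "S \<subseteq> P"
    and S_add: "s \<in> S \<Longrightarrow> t \<in> S \<Longrightarrow> s + t \<in> S"
    and S_mult: "s \<in> S \<Longrightarrow> t \<in> S \<Longrightarrow> s * t \<in> S"
    and S_square: "p \<in> P \<Longrightarrow> p\<^sup>2 \<in> S"
    and S_c: "k \<in> nonneg_elems K \<Longrightarrow> c k \<in> S"
begin

lemma S_c': "k \<in> K \<Longrightarrow> k \<ge> 0 \<Longrightarrow> c k \<in> S"
  by (simp add: S_c nonneg_elems_def)

lemma S_zero: "0 \<in> S"
  using S_c'[of 0] by (auto simp: c_zero intro: K_closed)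

lemma S_scale: "k \<in> K \<Longrightarrow> k \<ge> 0 \<Longrightarrow> s \<in> S \<Longrightarrow> c k * s \<in> S"
  by (simp add: S_mult S_c')

lemma sum_in_S: "(\<And>x. x \<in> A \<Longrightarrow> p x \<in> S) \<Longrightarrow> sum p A \<in> S"
  by (induction A rule: infinite_finite_induct) (auto intro: S_zero S_add)

text \<open>
  A form of the Cauchy-Schwarz inequality, obtained by iterating \<open>(x + z)\<^sup>2 \<le> 2 x\<^sup>2 + 2 z\<^sup>2\<close>.  The constant is
  far from optimal, but only its existence in \<open>K\<close> matters.
\<close>

lemma square_of_sum_bounded:
  assumes "finite B" "\<And>m. m \<in> B \<Longrightarrow> y m \<in> P" "\<And>m. m \<in> B \<Longrightarrow> e m \<in> K"
  shows "\<exists>k\<in>nonneg_elems K. c k * (\<Sum>m\<in>B. (y m)\<^sup>2) - (\<Sum>m\<in>B. c (e m) * y m)\<^sup>2 \<in> S"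
  using assms
proof (induction B)
  case empty
  show ?case using S_zero by (auto simp: nonneg_elems_def intro!: bexI[of _ 0] K_closed)
next
  case (insert b B)
  let ?V = "\<Sum>m\<in>B. (y m)\<^sup>2" and ?z = "\<Sum>m\<in>B. c (e m) * y m"
  obtain k where k: "k \<in> K" "k \<ge> 0" "c k * ?V - ?z\<^sup>2 \<in> S"
    using insert by (auto simp: nonneg_elems_def)
  have mem: "?z \<in> P" "y b \<in> P" "e b \<in> K" using insert by (auto intro!: P_closed)
  have V: "?V \<in> S" using insert.prems(1) insert.hyps(1)
    by (intro sum_in_S S_square) auto
  let ?k = "2 * (e b)\<^sup>2 + 2 * k"
  have "c ?k * ((y b)\<^sup>2 + ?V) - (c (e b) * y b + ?z)\<^sup>2 =
    (c (e b) * y b - ?z)\<^sup>2 + c 2 * (c k * ?V - ?z\<^sup>2) + c (2 * k) * (y b)\<^sup>2 + c (2 * (e b)\<^sup>2) * ?V"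
    unfolding c_simps by (simp add: power2_eq_square algebra_simps)
  also have "\<dots> \<in> S"
    using mem k V by (intro S_add S_scale S_square P_diff P_mult c_P K_closed mult_nonneg_nonneg) auto
  finally have "c ?k * (\<Sum>m\<in>insert b B. (y m)\<^sup>2) - (\<Sum>m\<in>insert b B. c (e m) * y m)\<^sup>2 \<in> S"
    using insert.hyps by simp
  moreover have "?k \<in> nonneg_elems K"
    using mem k by (auto simp: nonneg_elems_def intro!: K_closed)
  ultimately show ?case by blast
qed

text \<open>
  Let \<open>W\<close> be the sum of the squares of the generators.  Every square is at most a multiple of \<open>W\<close>, so
  the point is to bound \<open>W\<close> by a constant.  Since \<open>W\<^sup>2\<close> is itself at most \<open>k W\<close>, completing the square in
  \<open>0 \<le> (W - k)\<^sup>2\<close> gives \<open>k W \<le> k\<^sup>2\<close>, and \<open>k\<close> is invertible.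
\<close>

lemma archimedean_if_finite_dim_mod_ideal:
  assumes B: "finite B" "\<And>m. m \<in> B \<Longrightarrow> y m \<in> P"
    and J: "J \<subseteq> S" "ideal J"
    and span: "\<And>p. p \<in> P \<Longrightarrow> \<exists>q\<in>lin y B. p - q \<in> J"
    and p: "p \<in> P"
  shows "\<exists>k\<in>K. c k - p \<in> S"
proof -
  define W where "W = (\<Sum>m\<in>B. (y m)\<^sup>2)"
  have W: "W \<in> S" "W \<in> P"
    unfolding W_def using B by (auto intro!: sum_in_S S_square P_sum P_power)
  have bound: "\<exists>k\<in>nonneg_elems K. c k * W - q\<^sup>2 \<in> S" if q: "q \<in> P" for q
  proof -
    obtain z where z: "z \<in> lin y B" "q - z \<in> J" using span[OF q] by blast
    then obtain e where e: "z = (\<Sum>m\<in>B. c (e m) * y m)" "\<And>m. e m \<in> K"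
      by (auto simp: lin_def)
    then obtain k where k: "k \<in> nonneg_elems K" "c k * W - z\<^sup>2 \<in> S"
      using square_of_sum_bounded[of B y e] B unfolding W_def by blast
    have "z \<in> P" using z(1) lin_subset[of B y] B(2) by auto
    then have "- (q + z) \<in> P" using q by (auto intro!: P_closed)
    then have "- (q + z) * (q - z) \<in> S" using idealD(3)[OF J(2)] z(2) J(1) by blast
    moreover have "c k * W - q\<^sup>2 = (c k * W - z\<^sup>2) + (- (q + z) * (q - z))"
      by (simp add: power2_eq_square algebra_simps)
    ultimately show ?thesis using k S_add by metis
  qed
  obtain k0 where k0: "k0 \<in> nonneg_elems K" "c k0 * W - W\<^sup>2 \<in> S" using bound W by blast
  define k where "k = k0 + 1"
  have k: "k \<in> K" "k > 0" using k0 by (auto simp: k_def nonneg_elems_def intro!: K_closed)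
  have kinv: "c k * c (inverse k) = 1" using k c_inverse by simp
  have "((c k0 * W - W\<^sup>2) + W) + (W - c k)\<^sup>2 = c k * (c k - W)"
    by (simp add: k_def c_add c_one power2_eq_square algebra_simps)
  then have "c k - W = c (inverse k) * (((c k0 * W - W\<^sup>2) + W) + (W - c k)\<^sup>2)"
    using kinv by (metis mult.assoc mult.commute mult_1)
  also have "\<dots> \<in> S"
    using k W k0 by (intro S_scale S_add S_square P_closed) (auto intro: K_closed)
  finally have Wk: "c k - W \<in> S" .
  obtain l where l: "l \<in> K" "l \<ge> 0" "c l * W - p\<^sup>2 \<in> S"
    using bound[OF p] by (auto simp: nonneg_elems_def)
  have half: "c (1 / 2) * 2 = 1" using c_mult[of "1/2" 2] by (simp add: c_numeral c_one)
  have "c (1 / 2) * (((c l * W - p\<^sup>2) + c l * (c k - W)) + (p - 1)\<^sup>2) =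
      (c l * c k + 1) * c (1 / 2) - (c (1 / 2) * 2) * p"
    by (simp add: power2_eq_square algebra_simps)
  then have "c ((l * k + 1) * (1 / 2)) - p = c (1 / 2) * (((c l * W - p\<^sup>2) + c l * (c k - W)) + (p - 1)\<^sup>2)"
    unfolding c_mult c_add c_one using half by simp
  also have "\<dots> \<in> S"
    using p l Wk by (intro S_scale S_add S_square P_closed) (auto intro!: K_closed)
  finally show ?thesis using l k by (blast intro: K_closed)
qed

end

text \<open>
  Adding the ideal amounts to computing in the quotient: a real character that is nonnegative on the
  resulting set vanishes on \<open>J\<close>.
\<close>

lemma (in subfield_algebra) preordered_algebra_wsos_plus_ideal:
  assumes J: "ideal J"
  shows "preordered_algebra K c P {s + j | s j. s \<in> wsos P \<and> j \<in> J}" (is "preordered_algebra K c P ?S")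
proof
  note JD = idealD[OF J]
  have P: "s \<in> wsos P \<Longrightarrow> s \<in> P" for s using wsos_subset by blast
  have wS: "s \<in> wsos P \<Longrightarrow> s \<in> ?S" for s
    using JD(4) by (intro CollectI exI[of _ s] exI[of _ 0]) auto
  show "?S \<subseteq> P" using JD(1) P by (auto intro: P_add)
  show "x + y \<in> ?S" if xy: "x \<in> ?S" "y \<in> ?S" for x y
  proof -
    obtain s i t j where "x = s + i" "y = t + j" "s \<in> wsos P" "t \<in> wsos P" "i \<in> J" "j \<in> J"
      using xy by blast
    moreover from this have "x + y = (s + t) + (i + j)" by simp
    ultimately show ?thesis using wsos_add JD(2) by blast
  qed
  show "x * y \<in> ?S" if xy: "x \<in> ?S" "y \<in> ?S" for x y
  proof -
    obtain s i t j where st: "x = s + i" "y = t + j" "s \<in> wsos P" "t \<in> wsos P" "i \<in> J" "j \<in> J"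
      using xy by blast
    then have "(t + j) * i + s * j \<in> J" using JD P by (intro JD(2,3) P_add) auto
    moreover have "x * y = s * t + ((t + j) * i + s * j)" using st by (simp add: algebra_simps)
    ultimately show ?thesis using wsos_mult st(3,4) by blast
  qed
  show "p\<^sup>2 \<in> ?S" if "p \<in> P" for p
    using wS[OF wsos_term[OF _ that, of 1]] K_closed(2)
    unfolding nonneg_elems_def c_one mult_1_left by (metis (mono_tags) mem_Collect_eq zero_le_one)
  show "c k \<in> ?S" if "k \<in> nonneg_elems K" for k
    using wS[OF wsos_term[OF that P_one]] unfolding power_one mult_1_right .
qed

section \<open>Real characters of archimedean quadratic modules\<close>

text \<open>
  With \<open>k - s\<close> and \<open>s f - 1\<close> regarded as nonnegative and \<open>x\<close> a nonnegative constant, every summand on the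
  right is nonnegative if \<open>f + x\<close> is; hence so is \<open>f + x - 1/k\<close>.
\<close>

lemma denominator_clearing_identity:
  fixes k :: "'a::comm_ring_1"
  assumes "k * i = 1"
  shows "f + x - i =
    i\<^sup>2 * ((k - s)\<^sup>2 * (f + x) + (2 * k - s) * (s * f - 1) + x * (s * (2 * k - s)) + (k - s))"
proof -
  have 1: "(k - s)\<^sup>2 * (f + x) + (2 * k - s) * (s * f - 1) + x * (s * (2 * k - s)) + (k - s) =
      k * k * f + k * k * x - k"
    by (simp add: power2_eq_square algebra_simps)
  have "i\<^sup>2 * (k * k * f + k * k * x - k) = (k * i) * (k * i) * (f + x) - (k * i) * i"
    by (simp add: power2_eq_square algebra_simps)
  then show ?thesis unfolding 1 using assms by simp
qed

context preordered_algebra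
begin

definition quadratic_module :: "'a set \<Rightarrow> bool" where
  "quadratic_module M \<longleftrightarrow> M \<subseteq> P \<and> 1 \<in> M \<and> (\<forall>a\<in>M. \<forall>b\<in>M. a + b \<in> M) \<and> (\<forall>s\<in>S. \<forall>a\<in>M. s * a \<in> M)"

lemma quadratic_moduleD:
  assumes "quadratic_module M"
  shows "a \<in> M \<Longrightarrow> a \<in> P" "1 \<in> M" "a \<in> M \<Longrightarrow> b \<in> M \<Longrightarrow> a + b \<in> M"
    "s \<in> S \<Longrightarrow> a \<in> M \<Longrightarrow> s * a \<in> M" "s \<in> S \<Longrightarrow> s \<in> M"
    "k \<in> K \<Longrightarrow> k \<ge> 0 \<Longrightarrow> a \<in> M \<Longrightarrow> c k * a \<in> M"
proof -
  show *: "a \<in> M \<Longrightarrow> a \<in> P" "1 \<in> M" "a \<in> M \<Longrightarrow> b \<in> M \<Longrightarrow> a + b \<in> M"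
    and mult: "s \<in> S \<Longrightarrow> a \<in> M \<Longrightarrow> s * a \<in> M" for s a
    using assms by (auto simp: quadratic_module_def)
  show "s \<in> S \<Longrightarrow> s \<in> M" using mult[of s 1] *(2) by simp
  show "k \<in> K \<Longrightarrow> k \<ge> 0 \<Longrightarrow> a \<in> M \<Longrightarrow> c k * a \<in> M" by (simp add: mult S_c')
qed

lemma quadratic_module_extend:
  assumes Q: "quadratic_module Q" and a: "a \<in> P"
  shows "quadratic_module {q + s * a | q s. q \<in> Q \<and> s \<in> S}" (is "quadratic_module ?E")
    and "Q \<subseteq> {q + s * a | q s. q \<in> Q \<and> s \<in> S}" and "a \<in> {q + s * a | q s. q \<in> Q \<and> s \<in> S}"
proof -
  note QD = quadratic_moduleD[OF Q]
  show sub: "Q \<subseteq> ?E"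
  proof
    fix q assume "q \<in> Q"
    then show "q \<in> ?E" using S_zero by (intro CollectI exI[of _ q] exI[of _ 0]) auto
  qed
  have 1: "1 \<in> S" using S_square[of 1] P_one by simp
  have 0: "0 \<in> Q" using QD(5) S_zero by blast
  show "a \<in> ?E" using 0 1 by (intro CollectI exI[of _ 0] exI[of _ 1]) auto
  have "x + y \<in> ?E" if xy: "x \<in> ?E" "y \<in> ?E" for x y
  proof -
    obtain q s q' s' where "x = q + s * a" "y = q' + s' * a" "q \<in> Q" "s \<in> S" "q' \<in> Q" "s' \<in> S"
      using xy by blast
    moreover from this have "x + y = (q + q') + (s + s') * a" by (simp add: algebra_simps)
    ultimately show ?thesis using QD(3) S_add by blast
  qed
  moreover have "t * x \<in> ?E" if tx: "t \<in> S" "x \<in> ?E" for t x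
  proof -
    obtain q s where "x = q + s * a" "q \<in> Q" "s \<in> S" using tx by blast
    moreover from this have "t * x = t * q + (t * s) * a" by (simp add: algebra_simps)
    ultimately show ?thesis using QD(4) S_mult tx(1) by blast
  qed
  moreover have "?E \<subseteq> P" using QD(1) S_P a by (auto intro!: P_add P_mult)
  moreover have "1 \<in> ?E" using sub QD(2) by (rule subsetD)
  ultimately show "quadratic_module ?E" unfolding quadratic_module_def by (intro conjI ballI)
qed

lemma quadratic_module_generated:
  assumes A: "finite A" "i0 \<in> A" "G i0 = 1" "\<And>i. i \<in> A \<Longrightarrow> G i \<in> P"
  shows "quadratic_module {\<Sum>i\<in>A. \<sigma> i * G i | \<sigma>. \<forall>i. \<sigma> i \<in> S}" (is "quadratic_module ?M")
    and "i \<in> A \<Longrightarrow> G i \<in> {\<Sum>i\<in>A. \<sigma> i * G i | \<sigma>. \<forall>i. \<sigma> i \<in> S}"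
proof -
  have 1: "1 \<in> S" using S_square[of 1] P_one by simp
  show G: "G i \<in> ?M" if "i \<in> A" for i
  proof -
    have "(\<Sum>j\<in>A. (if j = i then 1 else 0) * G j) = (\<Sum>j\<in>A. if j = i then G j else 0)"
      by (intro sum.cong) auto
    also have "\<dots> = G i" using A(1) that by simp
    finally show ?thesis
      using 1 S_zero by (intro CollectI exI[of _ "\<lambda>j. if j = i then 1 else 0"]) auto
  qed
  have "a + b \<in> ?M" if ab: "a \<in> ?M" "b \<in> ?M" for a b
  proof -
    obtain \<sigma> \<tau> where "a = (\<Sum>i\<in>A. \<sigma> i * G i)" "b = (\<Sum>i\<in>A. \<tau> i * G i)"
      and "\<forall>i. \<sigma> i \<in> S" "\<forall>i. \<tau> i \<in> S" using ab by blast
    then show ?thesis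
      by (intro CollectI exI[of _ "\<lambda>i. \<sigma> i + \<tau> i"]) (simp add: distrib_right sum.distrib S_add)
  qed
  moreover have "s * a \<in> ?M" if sa: "s \<in> S" "a \<in> ?M" for s a
  proof -
    obtain \<sigma> where "a = (\<Sum>i\<in>A. \<sigma> i * G i)" "\<forall>i. \<sigma> i \<in> S" using sa(2) by blast
    then show ?thesis using sa(1)
      by (intro CollectI exI[of _ "\<lambda>i. s * \<sigma> i"]) (simp add: sum_distrib_left mult.assoc S_mult)
  qed
  moreover have "?M \<subseteq> P" using A(4) S_P by (auto intro!: P_sum P_mult)
  moreover have "1 \<in> ?M" using G[OF A(2)] A(3) by simp
  ultimately show "quadratic_module ?M" unfolding quadratic_module_def by (intro conjI ballI)
qed

text \<open>
  Zorn's lemma gives a module \<open>Q\<close> that is maximal without containing \<open>- 1\<close>.  If neither \<open>a\<close> nor \<open>- a\<close>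
  belonged to \<open>Q\<close>, adjoining either of them would produce \<open>- 1\<close>, and the two resulting relations can be
  combined to show that \<open>- 1\<close> was in \<open>Q\<close> already.
\<close>

lemma exists_total_quadratic_module:
  assumes N: "quadratic_module N" "- 1 \<notin> N"
  obtains Q where "N \<subseteq> Q" "quadratic_module Q" "- 1 \<notin> Q" "\<And>a. a \<in> P \<Longrightarrow> a \<in> Q \<or> - a \<in> Q"
proof -
  let ?F = "{Q. N \<subseteq> Q \<and> quadratic_module Q \<and> - 1 \<notin> Q}"
  have "?F \<noteq> {}" using N by blast
  moreover have "\<Union>C \<in> ?F" if C: "C \<noteq> {}" "subset.chain ?F C" for C
  proof -
    have CF: "C \<subseteq> ?F" and lin: "\<And>X Y. X \<in> C \<Longrightarrow> Y \<in> C \<Longrightarrow> X \<subseteq> Y \<or> Y \<subseteq> X"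
      using C(2) by (auto simp: subset_chain_def)
    have "a + b \<in> \<Union>C" if ab: "a \<in> \<Union>C" "b \<in> \<Union>C" for a b
    proof -
      obtain X Y where "X \<in> C" "Y \<in> C" "a \<in> X" "b \<in> Y" using ab by blast
      then obtain Z where "Z \<in> C" "a \<in> Z" "b \<in> Z" using lin by blast
      then show ?thesis using CF quadratic_moduleD(3) by blast
    qed
    moreover have "s * a \<in> \<Union>C" if "s \<in> S" "a \<in> \<Union>C" for s a
      using that CF quadratic_moduleD(4) by blast
    moreover have "\<Union>C \<subseteq> P" "1 \<in> \<Union>C" "N \<subseteq> \<Union>C" "- 1 \<notin> \<Union>C"
      using C(1) CF quadratic_moduleD(1,2) by blast+
    ultimately show ?thesis by (simp add: quadratic_module_def)
  qed
  ultimately obtain Q where Q: "Q \<in> ?F" and max: "\<And>X. X \<in> ?F \<Longrightarrow> Q \<subseteq> X \<Longrightarrow> X = Q"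
    by (metis (no_types, lifting) subset_Zorn_nonempty)
  have QM: "quadratic_module Q" and Q1: "- 1 \<notin> Q" and NQ: "N \<subseteq> Q" using Q by auto
  note QD = quadratic_moduleD[OF QM]
  have ext: "\<exists>q\<in>Q. \<exists>s\<in>S. - 1 = q + s * a" if a: "a \<in> P" "a \<notin> Q" for a
    using quadratic_module_extend[OF QM a(1)] max[of "{q + s * a | q s. q \<in> Q \<and> s \<in> S}"] NQ a(2)
    by blast
  have "a \<in> Q \<or> - a \<in> Q" if a: "a \<in> P" for a
  proof (rule ccontr)
    assume "\<not> ?thesis"
    then obtain q s q' t where q: "q \<in> Q" "s \<in> S" "- 1 = q + s * a"
      and q': "q' \<in> Q" "t \<in> S" "- 1 = q' + t * (- a)"
      using ext[of a] ext[of "- a"] a P_uminus by blast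
    \<comment> \<open>Eliminating \<open>a\<close> from the two relations shows that \<open>s\<close> lies in the support
      \<open>Q \<inter> - Q\<close>; as the support is an ideal, \<open>s * a\<close> lies in it as well.\<close>
    have "q = - 1 - s * a" "q' = - 1 + t * a"
      using q(3) q'(3) by (simp_all add: algebra_simps)
    then have "t * q + s * q' + t = t * (- 1 - s * a) + s * (- 1 + t * a) + t" by (simp only:)
    then have "- s = t * q + s * q' + t" by (simp add: algebra_simps)
    then have ms: "- s \<in> Q" using q q' QD by metis
    \<comment> \<open>These elements write \<open>a\<close> as a difference of two squares, and \<open>Q\<close> absorbs squares.\<close>
    define h where "h = c (1 / 2) * (a + 1)"
    define h' where "h' = c (1 / 2) * (a - 1)"
    have "c (1 / 2) * c (1 / 2) * 4 = 1"
      using c_mult[of "1 / 2 * (1 / 2)" 4] c_mult[of "1 / 2" "1 / 2"] by (simp add: c_numeral c_one)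
    moreover have "h\<^sup>2 - h'\<^sup>2 = (c (1 / 2) * c (1 / 2) * 4) * a"
      by (simp add: h_def h'_def power2_eq_square algebra_simps)
    ultimately have "a = h\<^sup>2 - h'\<^sup>2" by simp
    then have "s * a = s * (h\<^sup>2 - h'\<^sup>2)" by (simp only:)
    then have "s * a = h\<^sup>2 * s + h'\<^sup>2 * (- s)" by (simp add: algebra_simps)
    moreover have "h \<in> P" "h' \<in> P" using a by (auto simp: h_def h'_def intro!: P_closed K_closed)
    ultimately have "s * a \<in> Q" using ms QD q(2) S_square by metis
    then show False using q QD(3) Q1 by metis
  qed
  then show ?thesis using that NQ QM Q1 by blast
qed

end

locale archimedean_algebra = preordered_algebra K c P S for K c and P S :: "'a::comm_ring_1 set" +
  assumes arch: "p \<in> P \<Longrightarrow> \<exists>k\<in>K. c k - p \<in> S"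
begin

lemma arch_above:
  assumes "p \<in> P"
  obtains k where "k \<in> K" "k > b" "c k - p \<in> S"
proof -
  obtain k0 where k0: "k0 \<in> K" "c k0 - p \<in> S" using arch[OF assms] by blast
  obtain k where k: "k \<in> K" "max k0 b < k" 
    using subfield_real_dense[OF K, of "max k0 b" "max k0 b + 1"] by auto
  have "c (k - k0) + (c k0 - p) \<in> S"
    using k k0 by (intro S_add S_c' K_closed) auto
  moreover have "c k - p = c (k - k0) + (c k0 - p)" by (simp add: c_diff)
  ultimately have "c k - p \<in> S" by (simp only:)
  then show ?thesis using that k by auto
qed

text \<open>
  Some constant \<open>x\<close> satisfies \<open>f + x \<in> M\<close>, because \<open>S\<close> is archimedean.  The denominator \<open>s\<close> is bounded by a
  constant \<open>k\<close>, and the clearing identity lowers \<open>x\<close> by the fixed amount \<open>1/k\<close> as long as \<open>x \<ge> 0\<close>.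
  After finitely many steps \<open>x\<close> is negative, and then it can be dropped.
\<close>

lemma quadratic_module_cancel_denominator:
  assumes M: "quadratic_module M" and f: "f \<in> P" and s: "s \<in> S" "s * f - 1 \<in> M"
  shows "f \<in> M"
proof -
  note MD = quadratic_moduleD[OF M]
  obtain k where k: "k \<in> K" "k > 0" "c k - s \<in> S" using arch_above[of s 0] s(1) S_P by blast
  obtain x where x: "x \<in> K" "x > 0" "c x - (- f) \<in> S" using arch_above[of "- f" 0] f P_uminus by blast
  let ?i = "inverse k"
  have ki: "c k * c ?i = 1" using c_inverse k by simp
  have i: "?i \<in> K" "?i > 0" using k by (auto intro: K_closed)
  have sP: "s \<in> P" using s(1) S_P by blast
  have step: "f + c (x - ?i) \<in> M" if x: "x \<in> K" "x \<ge> 0" "f + c x \<in> M" for x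
  proof -
    have 2: "2 * c k - s = c k + (c k - s)" by simp
    have 2: "2 * c k - s \<in> S" unfolding 2 using k by (intro S_add S_c') auto
    have "f + c (x - ?i) = f + c x - c ?i" by (simp add: c_diff)
    also have "\<dots> = (c ?i)\<^sup>2 * ((c k - s)\<^sup>2 * (f + c x) + (2 * c k - s) * (s * f - 1) +
        c x * (s * (2 * c k - s)) + (c k - s))"
      by (rule denominator_clearing_identity[OF ki])
    also have "\<dots> \<in> M"
    proof -
      have "(c k - s)\<^sup>2 * (f + c x) \<in> M"
        using x k sP by (intro MD(4) S_square P_diff c_P)
      moreover have "(2 * c k - s) * (s * f - 1) \<in> M" using 2 s(2) by (rule MD(4))
      moreover have "c x * (s * (2 * c k - s)) \<in> M" using x 2 s(1) by (intro MD(6) MD(5) S_mult)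
      ultimately show ?thesis
        by (intro MD(4)[OF S_square[OF c_P[OF i(1)]]] MD(3) MD(5)[OF k(3)])
    qed
    finally show ?thesis .
  qed
  have "f \<in> M \<or> f + c (x - of_nat n * ?i) \<in> M" for n
  proof (induction n)
    case 0
    then show ?case using MD(5)[OF x(3)] by (simp add: add.commute)
  next
    case (Suc n)
    let ?x = "x - of_nat n * ?i"
    have xK: "?x \<in> K" using x(1) i(1) by (intro K_closed(7,4,10))
    show ?case
    proof (cases "?x \<ge> 0")
      case True
      then show ?thesis using Suc step[OF xK] by (auto simp: algebra_simps)
    next
      case False
      then have "c (- ?x) \<in> M" using xK by (intro MD(5) S_c' K_closed(5)[OF xK]) auto
      moreover have "f = (f + c ?x) + c (- ?x)" by (simp only: c_minus) simp
      ultimately show ?thesis using Suc MD(3) by metis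
    qed
  qed
  moreover obtain n where n: "of_nat n * ?i > x" using ex_less_of_nat_mult[OF i(2)] by blast
  ultimately have "f \<in> M \<or> f + c (x - of_nat n * ?i) \<in> M" by blast
  moreover have "c (of_nat n * ?i - x) \<in> M" 
    using n x(1) i(1) by (intro MD(5) S_c' K_closed(7,4,10)) auto
  moreover have "f = (f + c (x - of_nat n * ?i)) + c (of_nat n * ?i - x)" by (simp add: c_diff)
  ultimately show ?thesis using MD(3) by metis
qed

text \<open>
  Each \<open>a\<close> cuts \<open>K\<close> into the scalars below and above it, because \<open>Q\<close> contains \<open>a - r\<close> or \<open>r - a\<close> for every
  scalar \<open>r\<close>; as \<open>Q\<close> is archimedean, the cut is a real number \<open>L a\<close>.  Additivity and compatibility with
  scalars are immediate for cuts.  Multiplicativity is less obvious, since \<open>Q\<close> need not be closed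
  under products; by polarisation it suffices to treat squares, and there a product of an element of
  \<open>Q\<close> with an element of \<open>S\<close> is enough.
\<close>

lemma real_character_of_total_quadratic_module:
  assumes Q: "quadratic_module Q" "- 1 \<notin> Q" and total: "\<And>a. a \<in> P \<Longrightarrow> a \<in> Q \<or> - a \<in> Q"
  shows "\<exists>\<phi>. real_character \<phi> \<and> (\<forall>a\<in>Q. \<phi> a \<ge> 0)"
proof -
  note QD = quadratic_moduleD[OF Q(1)]
  define L where "L a = Sup {r\<in>K. a - c r \<in> Q}" for a
  have cQ: "c k \<in> Q \<longleftrightarrow> k \<ge> 0" if k: "k \<in> K" for k
  proof
    assume "c k \<in> Q"
    show "k \<ge> 0"
    proof (rule ccontr)
      assume "\<not> k \<ge> 0"
      then have k0: "k < 0" "k \<noteq> 0" by auto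
      have "- inverse k \<in> K" "- inverse k \<ge> 0" using k k0 by (auto intro!: K_closed)
      then have "c (- inverse k) * c k \<in> Q" using \<open>c k \<in> Q\<close> by (rule QD(6))
      moreover have "c (- inverse k) * c k = - 1"
        using c_inverse[OF k0(2)] by (simp add: c_minus mult.commute)
      ultimately show False using Q(2) by simp
    qed
  qed (use k QD(5) S_c' in blast)
  have bdd: "r \<le> k" if "k \<in> K" "r \<in> K" "c k - a \<in> Q" "a - c r \<in> Q" for k r a
  proof -
    have "c (k - r) \<in> Q" using QD(3)[OF that(3,4)] by (simp add: c_diff)
    then show ?thesis using cQ[of "k - r"] that by (simp add: K_closed)
  qed
  have bdd_above: "bdd_above {r\<in>K. a - c r \<in> Q}" and nonempty: "\<exists>r\<in>K. a - c r \<in> Q"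
    if a: "a \<in> P" for a
  proof -
    obtain k where "k \<in> K" "c k - a \<in> S" using arch[OF a] by blast
    then show "bdd_above {r\<in>K. a - c r \<in> Q}" using bdd QD(5) by (intro bdd_aboveI[of _ k]) auto
    obtain k where "k \<in> K" "c k - (- a) \<in> S" using arch[of "- a"] a P_uminus by blast
    then show "\<exists>r\<in>K. a - c r \<in> Q" using QD(5)
      by (intro bexI[of _ "- k"]) (auto simp: c_minus add.commute intro: K_closed)
  qed
  have below: "a - c r \<in> Q" if a: "a \<in> P" and r: "r \<in> K" "r < L a" for a r
  proof -
    obtain r' where r': "r' \<in> K" "a - c r' \<in> Q" "r < r'"
      using less_cSupD[of "{r\<in>K. a - c r \<in> Q}" r] nonempty[OF a] r unfolding L_def by auto
    have "a - c r = (a - c r') + c (r' - r)" by (simp add: c_diff)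
    moreover have "c (r' - r) \<in> Q" using cQ[of "r' - r"] r' r by (simp add: K_closed)
    ultimately show ?thesis using QD(3) r' by metis
  qed
  have upper: "r \<le> L a" if a: "a \<in> P" and r: "r \<in> K" "a - c r \<in> Q" for a r
    unfolding L_def using r by (intro cSup_upper bdd_above[OF a]) auto
  have above: "c r - a \<in> Q" if a: "a \<in> P" and r: "r \<in> K" "r > L a" for a r
    using upper[OF a r(1)] r total[of "a - c r"] a by (auto intro: P_closed)
  have L_eqI: "L a = x" if a: "a \<in> P"
    and 1: "\<And>r. r \<in> K \<Longrightarrow> r < x \<Longrightarrow> a - c r \<in> Q" and 2: "\<And>r. r \<in> K \<Longrightarrow> r > x \<Longrightarrow> c r - a \<in> Q" for a x
  proof (rule ccontr)
    assume "L a \<noteq> x"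
    then consider "L a < x" | "x < L a" by linarith
    then show False
    proof cases
      case 1
      then obtain r where r: "r \<in> K" "L a < r" "r < x" using subfield_real_dense[OF K] by blast
      then show False using upper[OF a r(1)] that(2)[of r] by force
    next
      case 2
      then obtain r where r: "r \<in> K" "x < r" "r < L a" using subfield_real_dense[OF K] by blast
      obtain r' where r': "r' \<in> K" "x < r'" "r' < r" using subfield_real_dense[OF K r(2)] by blast
      then show False using below[OF a r(1,3)] that(3)[of r'] bdd[of r' r a] r by force
    qed
  qed
  have L_c: "L (c k) = k" if "k \<in> K" for k
  proof (rule L_eqI)
    show "c k - c r \<in> Q" if "r \<in> K" "r < k" for r
      using cQ[of "k - r"] that \<open>k \<in> K\<close> by (simp add: K_closed c_diff)
    show "c r - c k \<in> Q" if "r \<in> K" "r > k" for r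
      using cQ[of "r - k"] that \<open>k \<in> K\<close> by (simp add: K_closed c_diff)
  qed (simp add: c_P that)
  have L_add: "L (a + b) = L a + L b" if a: "a \<in> P" and b: "b \<in> P" for a b
  proof (rule L_eqI)
    fix r assume r: "r \<in> K" "r < L a + L b"
    then obtain r1 where r1: "r1 \<in> K" "r - L b < r1" "r1 < L a"
      using subfield_real_dense[OF K, of "r - L b" "L a"] by auto
    have "(a - c r1) + (b - c (r - r1)) \<in> Q"
      using r r1 by (intro QD(3) below a b K_closed) auto
    then show "a + b - c r \<in> Q" by (simp add: c_diff algebra_simps)
  next
    fix r assume r: "r \<in> K" "r > L a + L b"
    then obtain r1 where r1: "r1 \<in> K" "L a < r1" "r1 < r - L b"
      using subfield_real_dense[OF K, of "L a" "r - L b"] by auto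
    have "(c r1 - a) + (c (r - r1) - b) \<in> Q"
      using r r1 by (intro QD(3) above a b K_closed) auto
    then show "c r - (a + b) \<in> Q" by (simp add: c_diff algebra_simps)
  qed (use a b P_add in blast)
  have L_minus: "L (- a) = - L a" if a: "a \<in> P" for a
    using L_add[OF a P_uminus[OF a]] L_c[of 0] by (simp add: c_zero K_closed)
  have L_nonneg: "L a \<ge> 0" if "a \<in> Q" for a
    using upper[of a 0] that QD(1) by (simp add: c_zero K_closed)
  have L_scale_pos: "L (c k * a) = k * L a" if k: "k \<in> K" "k > 0" and a: "a \<in> P" for k a
  proof (rule L_eqI)
    have i: "c k * c (r / k) = c r" for r using k c_mult[of k "r / k"] by simp
    fix r assume r: "r \<in> K"
    {
      assume "r < k * L a"
      then have "c k * (a - c (r / k)) \<in> Q"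
        using r k by (intro QD(6) below a K_closed) (auto simp: field_simps)
      then show "c k * a - c r \<in> Q" by (simp add: i right_diff_distrib)
    next
      assume "r > k * L a"
      then have "c k * (c (r / k) - a) \<in> Q"
        using r k by (intro QD(6) above a K_closed) (auto simp: field_simps)
      then show "c r - c k * a \<in> Q" by (simp add: i right_diff_distrib)
    }
  qed (intro P_mult c_P a k)
  have L_scale: "L (c k * a) = k * L a" if k: "k \<in> K" and a: "a \<in> P" for k a
  proof -
    consider "k > 0" | "k = 0" | "k < 0" by linarith
    then show ?thesis
    proof cases
      case 3
      have "L (- (c (- k) * a)) = - (- k * L a)"
        using 3 k a L_scale_pos[of "- k" a] L_minus[of "c (- k) * a"] by (simp add: K_closed P_closed)
      then show ?thesis by (simp add: c_minus)
    qed (use k a L_scale_pos L_c[of 0] in \<open>auto simp: c_zero\<close>)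
  qed
  have L_square: "L (a\<^sup>2) = (L a)\<^sup>2" if a: "a \<in> P" for a
  proof (rule ccontr)
    define D where "D = \<bar>L (a\<^sup>2) - (L a)\<^sup>2\<bar>"
    assume "L (a\<^sup>2) \<noteq> (L a)\<^sup>2"
    then have D: "D > 0" by (simp add: D_def)
    obtain k where k: "k \<in> K" "k > \<bar>L a\<bar>" "c k - a \<in> S" using arch_above[OF a] by blast
    \<comment> \<open>\<open>N\<close> bounds \<open>a - r\<close> uniformly for all \<open>r\<close> within distance one below \<open>L a\<close>.\<close>
    obtain N where N: "N \<in> K" "N > k + 1 - L a" "N > 0"
      using subfield_real_dense[OF K, of "max 0 (k + 1 - L a)" "max 0 (k + 1 - L a) + 1"] by auto
    define \<epsilon> where "\<epsilon> = min 1 (D / (N + 1))"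
    have \<epsilon>: "\<epsilon> > 0" using D N by (simp add: \<epsilon>_def)
    obtain r where r: "r \<in> K" "L a - \<epsilon> < r" "r < L a"
      using subfield_real_dense[OF K, of "L a - \<epsilon>" "L a"] \<epsilon> by auto
    \<comment> \<open>\<open>b\<close> has a value close to zero and both \<open>b\<close> and \<open>N - b\<close> are nonnegative,
      which forces the value of \<open>b\<^sup>2\<close> to be close to zero.\<close>
    define b where "b = a - c r"
    define \<delta> where "\<delta> = L a - r"
    have bP: "b \<in> P" using a r by (auto simp: b_def intro: P_closed)
    have bQ: "b \<in> Q" unfolding b_def by (rule below[OF a r(1,3)])
    have \<delta>: "\<delta> > 0" "\<delta> < \<epsilon>" using r by (auto simp: \<delta>_def)
    have mr: "- r \<in> K" using r K_closed by blast
    have Lb: "L b = \<delta>"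
      using L_add[OF a c_P[OF mr]] L_c[OF mr] by (simp add: b_def \<delta>_def c_minus)
    have "N - k + r \<ge> 0" using N(2) r(2) \<epsilon>_def by linarith
    moreover have "N - k + r \<in> K" using N(1) k(1) r(1) by (intro K_closed(3,7))
    ultimately have "c (N - k + r) + (c k - a) \<in> S" by (intro S_add k(3) S_c')
    then have "c N - b \<in> S" by (simp add: b_def c_add c_diff algebra_simps)
    then have "(c N - b) * b \<in> Q" using bQ QD(4) by blast
    then have "0 \<le> L ((c N - b) * b)" by (rule L_nonneg)
    also have "(c N - b) * b = c N * b + - (b\<^sup>2)" by (simp add: power2_eq_square algebra_simps)
    also have "L (c N * b + - (b\<^sup>2)) = N * \<delta> - L (b\<^sup>2)"
      using L_add[of "c N * b" "- (b\<^sup>2)"] L_minus[of "b\<^sup>2"] L_scale[OF N(1) bP] bP N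
      by (simp add: P_closed Lb)
    finally have b2: "L (b\<^sup>2) \<le> N * \<delta>" by simp
    have b2': "L (b\<^sup>2) \<ge> 0" using L_nonneg QD(5) S_square bP by blast
    have "a\<^sup>2 = b\<^sup>2 + (c (2 * r) * b + c (r\<^sup>2))"
      by (simp add: b_def c_simps power2_eq_square algebra_simps)
    then have "L (a\<^sup>2) = L (b\<^sup>2) + (2 * r * \<delta> + r\<^sup>2)"
      using L_add[of "b\<^sup>2" "c (2 * r) * b + c (r\<^sup>2)"] L_add[of "c (2 * r) * b" "c (r\<^sup>2)"]
        L_scale[of "2 * r" b] L_c[of "r\<^sup>2"] bP r
      by (simp add: P_closed K_closed Lb)
    moreover have "(L a)\<^sup>2 = \<delta>\<^sup>2 + (2 * r * \<delta> + r\<^sup>2)"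
      by (simp add: \<delta>_def power2_eq_square algebra_simps)
    ultimately have "D = \<bar>L (b\<^sup>2) - \<delta>\<^sup>2\<bar>" by (simp add: D_def)
    also have "\<dots> \<le> N * \<delta> + \<delta>\<^sup>2" using b2 b2' zero_le_power2[of \<delta>] by linarith
    also have "\<delta>\<^sup>2 \<le> \<delta>"
      using \<delta> unfolding \<epsilon>_def power2_eq_square by (intro mult_left_le) auto
    also have "N * \<delta> + \<delta> = (N + 1) * \<delta>" by (simp add: algebra_simps)
    also have "\<dots> < (N + 1) * (D / (N + 1))" using \<delta> N by (intro mult_strict_left_mono) (auto simp: \<epsilon>_def)
    also have "\<dots> = D" using N by simp
    finally show False by simp
  qed
  have "L (a * b) = L a * L b" if a: "a \<in> P" and b: "b \<in> P" for a b
  proof -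
    have "(a + b)\<^sup>2 = (a * b + a * b) + (a\<^sup>2 + b\<^sup>2)" by (simp add: power2_eq_square algebra_simps)
    then have "L ((a + b)\<^sup>2) = L ((a * b + a * b) + (a\<^sup>2 + b\<^sup>2))" by (simp only:)
    also have "\<dots> = (L (a * b) + L (a * b)) + (L (a\<^sup>2) + L (b\<^sup>2))"
      using a b by (simp only: L_add P_add P_mult P_power)
    finally have "(L a + L b)\<^sup>2 = (L (a * b) + L (a * b)) + ((L a)\<^sup>2 + (L b)\<^sup>2)"
      using a b by (simp only: L_square L_add P_add)
    then show ?thesis by (simp add: power2_eq_square algebra_simps)
  qed
  then have "real_character L" using L_c L_add by (simp add: real_character_def)
  then show ?thesis using L_nonneg by blast
qed

text \<open>
  If \<open>- 1 = a - s f\<close> with \<open>a \<in> M\<close> and \<open>s \<in> S\<close>, then \<open>s f - 1 \<in> M\<close> and the denominator \<open>s\<close> can be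
  cancelled.  Otherwise the module generated by \<open>M\<close> and \<open>- f\<close> extends to a total one, whose character
  contradicts the positivity of \<open>f\<close>.
\<close>

theorem archimedean_representation:
  assumes M: "quadratic_module M" and f: "f \<in> P"
    and pos: "\<And>\<phi>. real_character \<phi> \<Longrightarrow> (\<And>a. a \<in> M \<Longrightarrow> \<phi> a \<ge> 0) \<Longrightarrow> \<phi> f > 0"
  shows "f \<in> M"
proof (rule ccontr)
  assume "f \<notin> M"
  have mf: "- f \<in> P" using f P_uminus by blast
  let ?N = "{a + s * (- f) | a s. a \<in> M \<and> s \<in> S}"
  note N = quadratic_module_extend[OF M mf]
  \<comment> \<open>Otherwise there is a certificate \<open>s * f = 1 + a\<close> with a denominator \<open>s\<close>.\<close>
  have "- 1 \<notin> ?N"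
  proof
    assume "- 1 \<in> ?N"
    then obtain a s where "a \<in> M" "s \<in> S" "- 1 = a + s * (- f)" by blast
    moreover from this have "s * f - 1 = a" by (simp add: algebra_simps)
    ultimately show False using quadratic_module_cancel_denominator[OF M f] \<open>f \<notin> M\<close> by metis
  qed
  then obtain Q where Q: "?N \<subseteq> Q" "quadratic_module Q" "- 1 \<notin> Q" "\<And>a. a \<in> P \<Longrightarrow> a \<in> Q \<or> - a \<in> Q"
    using exists_total_quadratic_module[OF N(1)] by blast
  obtain \<phi> where \<phi>: "real_character \<phi>" "\<And>a. a \<in> Q \<Longrightarrow> \<phi> a \<ge> 0"
    using real_character_of_total_quadratic_module[OF Q(2-4)] by auto
  have "\<phi> f > 0" using \<phi>(2) N(2) Q(1) by (intro pos[OF \<phi>(1)]) blast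
  moreover have "\<phi> (- f) \<ge> 0" using \<phi>(2) N(3) Q(1) by blast
  moreover have "\<phi> (f + - f) = \<phi> f + \<phi> (- f)" using \<phi>(1) f mf unfolding real_character_def by blast
  moreover have "\<phi> (c 0) = 0" using \<phi>(1) K_closed(1) unfolding real_character_def by blast
  ultimately show False by (simp add: c_zero)
qed

text \<open>
  Modulo \<open>J\<close> the element \<open>e = v f\<close> is idempotent and \<open>e f = f\<close>.  A character gives \<open>e\<close> the value \<open>1\<close> if it
  does not vanish at \<open>f\<close>, and \<open>0\<close> otherwise; so \<open>f + (1 - e)\<close> is strictly positive under all
  characters considered.  Multiplication by \<open>e\<^sup>2\<close> removes the correction term \<open>1 - e\<close>.
\<close>

theorem archimedean_representation_nonneg:
  assumes M: "quadratic_module M" and J: "J \<subseteq> S" "ideal J"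
    and f: "f \<in> P" and v: "v \<in> P" "f - v * f\<^sup>2 \<in> J"
    and nonneg: "\<And>\<phi>. real_character \<phi> \<Longrightarrow> (\<And>a. a \<in> M \<Longrightarrow> \<phi> a \<ge> 0) \<Longrightarrow> \<phi> f \<ge> 0"
  shows "f \<in> M"
proof -
  note MD = quadratic_moduleD[OF M]
  let ?d = "f - v * f\<^sup>2"
  let ?f' = "f + (1 - v * f)"
  have "?f' \<in> M"
  proof (rule archimedean_representation[OF M])
    fix \<phi> assume \<phi>: "real_character \<phi>" "\<And>a. a \<in> M \<Longrightarrow> \<phi> a \<ge> 0"
    note hom = real_characterD[OF \<phi>(1)]
    have "- 1 * ?d \<in> J" by (intro idealD(3)[OF J(2) _ v(2)] P_uminus P_one)
    then have "\<phi> ?d \<ge> 0" "\<phi> (- ?d) \<ge> 0" using \<phi>(2) J(1) v(2) MD(5) by auto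
    moreover have dP: "?d \<in> P" using f v by (intro P_closed)
    moreover have "\<phi> ?d = \<phi> f - \<phi> v * (\<phi> f)\<^sup>2"
      using f v by (simp add: hom P_diff P_mult P_power)
    ultimately have "\<phi> f * (1 - \<phi> v * \<phi> f) = 0"
      using hom(4)[OF dP] by (simp add: power2_eq_square algebra_simps)
    moreover have "\<phi> ?f' = \<phi> f + (1 - \<phi> v * \<phi> f)"
      using f v by (simp add: hom P_diff P_mult P_one)
    moreover have "\<phi> f \<ge> 0" using nonneg \<phi> by blast
    ultimately show "\<phi> ?f' > 0"
      by (cases "\<phi> f = 0") auto
  qed (intro P_add P_diff P_mult P_one f v(1))
  then have "(v * f)\<^sup>2 * ?f' \<in> M" using f v by (intro MD(4) S_square P_mult)
  moreover have "(1 + v * f - v * f * v) * ?d \<in> M"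
    using f v(1) by (intro MD(5) subsetD[OF J(1)] idealD(3)[OF J(2) _ v(2)] P_closed)
  moreover have "f = (v * f)\<^sup>2 * ?f' + (1 + v * f - v * f * v) * ?d"
    by (simp add: power2_eq_square algebra_simps)
  ultimately show ?thesis using MD(3) by metis
qed

end

section \<open>Polynomials over a subfield of the reals\<close>

abbreviation monom :: "'n monomial \<Rightarrow> 'n mpoly" where
  "monom m \<equiv> Poly_Mapping.single m 1"

lemma const_mult_mono: "const a * monom m = Poly_Mapping.single m a"
  by (simp add: const_def mult_single)

lemma mpoly_eq_sum_monomials:
  "(p :: 'n mpoly) = (\<Sum>m\<in>Poly_Mapping.keys p. const (Poly_Mapping.lookup p m) * monom m)"
proof (rule poly_mapping_eqI)
  fix m
  have "Poly_Mapping.lookup (\<Sum>m\<in>Poly_Mapping.keys p. const (Poly_Mapping.lookup p m) * monom m) m =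
      (\<Sum>x\<in>Poly_Mapping.keys p. if x = m then Poly_Mapping.lookup p x else 0)"
    by (simp add: const_mult_mono lookup_sum lookup_single when_def)
  also have "\<dots> = Poly_Mapping.lookup p m"
    by (simp add: in_keys_iff)
  finally show "Poly_Mapping.lookup p m =
    Poly_Mapping.lookup (\<Sum>m\<in>Poly_Mapping.keys p. const (Poly_Mapping.lookup p m) * monom m) m" by simp
qed

lemma mono_eq_prod:
  fixes m :: "'n::finite monomial"
  shows "monom m = (\<Prod>i\<in>UNIV. monom (Poly_Mapping.single i 1) ^ Poly_Mapping.lookup m i)"
proof -
  have pow: "monom (Poly_Mapping.single i 1) ^ k = monom (Poly_Mapping.single i k)" for i :: 'n and k
    by (induction k) (auto simp: mult_single single_add[symmetric])
  have "(\<Prod>i\<in>A. monom (Poly_Mapping.single i (Poly_Mapping.lookup m i))) =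
      monom (\<Sum>i\<in>A. Poly_Mapping.single i (Poly_Mapping.lookup m i))" if "finite A" for A
    using that by induction (auto simp: mult_single)
  moreover have "(\<Sum>i\<in>UNIV. Poly_Mapping.single i (Poly_Mapping.lookup m i)) = m"
    by (rule poly_mapping_eqI) (simp add: lookup_sum lookup_single when_def)
  ultimately show ?thesis unfolding pow by simp
qed

lemma polys_algebra:
  assumes K: "subfield_real K"
  shows "subfield_algebra K const (polys K :: 'n mpoly set)"
proof
  note KC = subfield_real_closed[OF K]
  show "subfield_real K" by (fact K)
  show "const 1 = 1" by (simp add: const_def)
  show "const (a + b) = const a + const b" for a b by (simp add: const_def single_add)
  show "const (a * b) = const a * const b" for a b by (simp add: const_def mult_single)
  have single: "Poly_Mapping.single m k \<in> polys K" if "k \<in> K" for m k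
    using that KC(1) by (simp add: polys_def lookup_single when_def)
  then show "const k \<in> polys K" if "k \<in> K" for k using that by (simp add: const_def)
  show add: "p + q \<in> polys K" if "p \<in> polys K" "q \<in> polys K" for p q
    using that KC(3) by (simp add: polys_def lookup_add)
  have sum: "sum t A \<in> polys K" if "\<And>x. x \<in> A \<Longrightarrow> t x \<in> polys K" for A and t :: "'b \<Rightarrow> 'n mpoly"
    using that KC(1)
    by (induction A rule: infinite_finite_induct) (auto simp: add, simp_all add: polys_def)
  show "p * q \<in> polys K" if pq: "p \<in> polys K" "q \<in> polys K" for p q :: "'n mpoly"
  proof -
    have "p * q = (\<Sum>m\<in>Poly_Mapping.keys p. \<Sum>m'\<in>Poly_Mapping.keys q.
        Poly_Mapping.single (m + m') (Poly_Mapping.lookup p m * Poly_Mapping.lookup q m'))"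
      by (subst mpoly_eq_sum_monomials[of p], subst mpoly_eq_sum_monomials[of q])
         (simp add: const_mult_mono sum_product mult_single)
    also have "\<dots> \<in> polys K"
      using pq KC(4) by (intro sum single) (simp add: polys_def)
    finally show ?thesis .
  qed
qed

text \<open>
  This identifies the span of \<open>B\<close>, given by finite partial sums, with the coefficient functions on
  all of \<open>B\<close> that the diagonalisation uses.
\<close>

lemma mono_span_eq_lin:
  fixes B :: "'n monomial set"
  assumes K: "subfield_real K" and B: "finite B"
  shows "mono_span K B = subfield_algebra.lin K const monom B"
proof -
  interpret subfield_algebra K const "polys K :: 'n mpoly set" by (rule polys_algebra[OF K])
  show ?thesis
  proof (intro equalityI subsetI)
    fix p assume "p \<in> mono_span K B"
    then obtain e F where F: "p = (\<Sum>m\<in>F. Poly_Mapping.single m (e m))" "F \<subseteq> B" "\<forall>m\<in>F. e m \<in> K"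
      by (auto simp: mono_span_def)
    have "p = (\<Sum>m\<in>B. const (if m \<in> F then e m else 0) * monom m)"
      unfolding F(1) const_mult_mono using F(2) B by (intro sum.mono_neutral_cong_left) auto
    moreover have "\<forall>m. (if m \<in> F then e m else 0) \<in> K" using F(3) K_closed(1) by simp
    ultimately show "p \<in> lin monom B" unfolding lin_def by fast
  next
    fix p assume "p \<in> lin monom B"
    then show "p \<in> mono_span K B"
      using B unfolding lin_def mono_span_def const_mult_mono by blast
  qed
qed

text \<open>
  The point has the values of the character at the variables as its coordinates.
\<close>

lemma real_character_polys_is_evaluation:
  fixes \<phi> :: "'n::finite mpoly \<Rightarrow> real"
  assumes K: "subfield_real K" and \<phi>: "subfield_algebra.real_character K const (polys K) \<phi>"
  obtains \<xi> :: "real ^ 'n" where "\<And>p. p \<in> polys K \<Longrightarrow> \<phi> p = eval p \<xi>"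
proof -
  interpret subfield_algebra K const "polys K :: 'n mpoly set" by (rule polys_algebra[OF K])
  note hom = real_characterD[OF \<phi>]
  define \<xi> :: "real ^ 'n" where "\<xi> = (\<chi> i. \<phi> (monom (Poly_Mapping.single i 1)))"
  have mono_in: "monom m \<in> polys K" for m :: "'n monomial"
    using K_closed(1,2) by (simp add: polys_def lookup_single when_def)
  have mono: "\<phi> (monom m) = (\<Prod>i\<in>UNIV. (\<xi> $ i) ^ Poly_Mapping.lookup m i)" for m
  proof -
    have "\<phi> (monom m) = (\<Prod>i\<in>UNIV. \<phi> (monom (Poly_Mapping.single i 1) ^ Poly_Mapping.lookup m i))"
      by (subst mono_eq_prod) (intro conjunct2[OF real_character_prod[OF \<phi>]] P_power mono_in)
    then show ?thesis by (simp add: hom(8)[OF mono_in] \<xi>_def)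
  qed
  have "\<phi> p = eval p \<xi>" if p: "p \<in> polys K" for p
  proof -
    have coeff: "Poly_Mapping.lookup p m \<in> K" for m using p by (simp add: polys_def)
    have "\<phi> p = (\<Sum>m\<in>Poly_Mapping.keys p. \<phi> (const (Poly_Mapping.lookup p m) * monom m))"
      by (subst mpoly_eq_sum_monomials) (intro real_character_sum[OF \<phi>] P_mult c_P coeff mono_in)
    also have "\<dots> = eval p \<xi>"
      unfolding eval_def
      by (intro sum.cong refl) (simp add: hom(3)[OF c_P[OF coeff] mono_in] hom(1)[OF coeff] mono)
    finally show ?thesis .
  qed
  then show ?thesis using that by blast
qed

section \<open>Degrees\<close>

lemma monomial_deg_add: "monomial_deg (m + m') = monomial_deg m + monomial_deg m'"
  by (simp add: monomial_deg_def lookup_add sum.distrib)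

lemma deg_le_iff: "deg p \<le> n \<longleftrightarrow> (\<forall>m\<in>Poly_Mapping.keys p. monomial_deg m \<le> n)"
  by (auto simp: deg_def)

lemma deg_add_le: "deg p \<le> n \<Longrightarrow> deg q \<le> n \<Longrightarrow> deg (p + q) \<le> n"
  using keys_add[of p q] by (auto simp: deg_le_iff)

lemma deg_diff_le: "deg p \<le> n \<Longrightarrow> deg q \<le> n \<Longrightarrow> deg (p - q) \<le> n"
  using deg_add_le[of p n "- q"] by (simp add: deg_le_iff)

lemma deg_sum_le: "(\<And>x. x \<in> A \<Longrightarrow> deg (t x) \<le> n) \<Longrightarrow> deg (sum t A) \<le> n"
proof (induction A rule: infinite_finite_induct)
  case (insert x A)
  then show ?case by (simp add: deg_add_le)
qed (simp_all add: deg_def)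

lemma deg_mult_le: "deg p \<le> a \<Longrightarrow> deg q \<le> b \<Longrightarrow> deg (p * q) \<le> a + b"
  using keys_mult[of p q] by (fastforce simp: deg_le_iff monomial_deg_add intro: add_mono)

lemma deg_const: "deg (const a) \<le> n"
  by (auto simp: deg_le_iff const_def monomial_deg_def split: if_splits)

lemma deg_mono_span_le:
  assumes "q \<in> mono_span K B" "\<And>m. m \<in> B \<Longrightarrow> monomial_deg m \<le> d"
  shows "deg q \<le> d"
  using assms by (auto simp: mono_span_def deg_le_iff[of "Poly_Mapping.single _ _"] split: if_splits intro!: deg_sum_le)

section \<open>Generated ideals\<close>

text \<open>
  The definition sums over a finite set of generators, whereas the representation sought is indexed
  by \<open>A\<close>.  As \<open>h\<close> need not be injective, a representative index is chosen for each generator in one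
  direction, and coefficients of equal generators are collected in the other.
\<close>

lemma ideal_gen_eq_combinations:
  fixes h :: "'j \<Rightarrow> 'n mpoly"
  assumes K: "subfield_real K" and A: "finite A"
  shows "ideal_gen K (h ` A) = {\<Sum>j\<in>A. a j * h j | a. \<forall>j\<in>A. a j \<in> polys K}"
proof (intro equalityI subsetI)
  interpret subfield_algebra K const "polys K :: 'n mpoly set" by (rule polys_algebra[OF K])
  fix p assume "p \<in> ideal_gen K (h ` A)"
  then obtain a F where F: "p = (\<Sum>u\<in>F. a u * u)" "F \<subseteq> h ` A" "\<forall>u\<in>F. a u \<in> polys K"
    by (auto simp: ideal_gen_def)
  obtain J where J: "J \<subseteq> A" "inj_on h J" "F = h ` J"
    using F(2) by (auto simp: subset_image_inj)
  have "p = (\<Sum>j\<in>J. a (h j) * h j)" unfolding F(1) J(3) by (simp add: sum.reindex[OF J(2)])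
  also have "\<dots> = (\<Sum>j\<in>A. (if j \<in> J then a (h j) else 0) * h j)"
    using J(1) A by (intro sum.mono_neutral_cong_left) auto
  finally show "p \<in> {\<Sum>j\<in>A. a j * h j | a. \<forall>j\<in>A. a j \<in> polys K}"
    using F(3) J(3) P_zero by (intro CollectI exI[of _ "\<lambda>j. if j \<in> J then a (h j) else 0"]) auto
next
  interpret subfield_algebra K const "polys K :: 'n mpoly set" by (rule polys_algebra[OF K])
  fix p assume "p \<in> {\<Sum>j\<in>A. a j * h j | a. \<forall>j\<in>A. a j \<in> polys K}"
  then obtain a where a: "p = (\<Sum>j\<in>A. a j * h j)" "\<forall>j\<in>A. a j \<in> polys K" by blast
  have "p = (\<Sum>u\<in>h ` A. \<Sum>j\<in>{j\<in>A. h j = u}. a j * h j)"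
    unfolding a(1) by (rule sum.image_gen[OF A])
  also have "\<dots> = (\<Sum>u\<in>h ` A. (\<Sum>j\<in>{j\<in>A. h j = u}. a j) * u)"
    by (rule sum.cong[OF refl], subst sum_distrib_right, rule sum.cong) auto
  finally have "p = (\<Sum>u\<in>h ` A. (\<Sum>j\<in>{j\<in>A. h j = u}. a j) * u)" .
  moreover have "\<forall>u\<in>h ` A. (\<Sum>j\<in>{j\<in>A. h j = u}. a j) \<in> polys K"
    using a(2) by (auto intro!: P_sum)
  ultimately show "p \<in> ideal_gen K (h ` A)"
    using A unfolding ideal_gen_def
    by (intro CollectI exI[of _ "\<lambda>u. \<Sum>j\<in>{j\<in>A. h j = u}. a j"] exI[of _ "h ` A"]) auto
qed

lemma ideal_gen_is_ideal:
  fixes h :: "'j \<Rightarrow> 'n mpoly"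
  assumes K: "subfield_real K" and A: "finite A" "\<And>j. j \<in> A \<Longrightarrow> h j \<in> polys K"
  shows "subfield_algebra.ideal (polys K) (ideal_gen K (h ` A))"
    and "j \<in> A \<Longrightarrow> h j \<in> ideal_gen K (h ` A)"
proof -
  interpret subfield_algebra K const "polys K :: 'n mpoly set" by (rule polys_algebra[OF K])
  note I = ideal_gen_eq_combinations[OF K A(1), of h]
  let ?I = "{\<Sum>j\<in>A. a j * h j | a. \<forall>j\<in>A. a j \<in> polys K}"
  have "?I \<subseteq> polys K" using A(2) by (auto intro!: P_sum P_mult)
  moreover have "0 \<in> ?I" using P_zero by (intro CollectI exI[of _ "\<lambda>_. 0"]) simp
  moreover have "x + y \<in> ?I" if xy: "x \<in> ?I" "y \<in> ?I" for x y
  proof -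
    obtain a b where "x = (\<Sum>j\<in>A. a j * h j)" "\<forall>j\<in>A. a j \<in> polys K"
      "y = (\<Sum>j\<in>A. b j * h j)" "\<forall>j\<in>A. b j \<in> polys K" using xy by blast
    then show ?thesis
      by (intro CollectI exI[of _ "\<lambda>j. a j + b j"]) (simp add: distrib_right sum.distrib P_add)
  qed
  moreover have "p * x \<in> ?I" if px: "p \<in> polys K" "x \<in> ?I" for p x
  proof -
    obtain a where "x = (\<Sum>j\<in>A. a j * h j)" "\<forall>j\<in>A. a j \<in> polys K" using px(2) by blast
    then show ?thesis using px(1)
      by (intro CollectI exI[of _ "\<lambda>j. p * a j"]) (simp add: sum_distrib_left mult.assoc P_mult)
  qed
  ultimately show "ideal (ideal_gen K (h ` A))" unfolding I ideal_def by (intro conjI ballI)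
  show "h j \<in> ideal_gen K (h ` A)" if "j \<in> A"
  proof -
    have "h j = (\<Sum>u\<in>{h j}. 1 * u)" by simp
    then show ?thesis using that P_one unfolding ideal_gen_def
      by (intro CollectI exI[of _ "\<lambda>_. 1"] exI[of _ "{h j}"]) auto
  qed
qed

section \<open>Representation of polynomials on a finite variety\<close>

lemma ideal_gen_singleton:
  assumes "subfield_real K"
  shows "ideal_gen K {u} = {a * u | a. a \<in> polys K}"
proof -
  have "ideal_gen K (id ` {u}) = {\<Sum>j\<in>{u}. a j * id j | a. \<forall>j\<in>{u}. a j \<in> polys K}"
    by (rule ideal_gen_eq_combinations[OF assms]) simp
  also have "\<dots> = {a * u | a. a \<in> polys K}" by force
  finally show ?thesis by simp
qed

text \<open>
  Writing \<open>1 = u + v f\<close> with \<open>f u \<in> I\<close> and multiplying by \<open>f\<close> shows that \<open>f\<close> agrees with \<open>v f\<^sup>2\<close> modulo \<open>I\<close>.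
\<close>

lemma quasi_inverse_of_comaximal_colon:
  fixes f :: "'n mpoly"
  assumes K: "subfield_real K" and I: "subfield_algebra.ideal (polys K) I" and f: "f \<in> polys K"
    and comax: "ideal_sum (colon_ideal K I f) (ideal_gen K {f}) = ideal_gen K {1}"
  obtains v where "v \<in> polys K" "f - v * f\<^sup>2 \<in> I"
proof -
  interpret subfield_algebra K const "polys K :: 'n mpoly set" by (rule polys_algebra[OF K])
  have "(1 :: 'n mpoly) \<in> ideal_gen K {1}" 
    using P_one unfolding ideal_gen_singleton[OF K] by (intro CollectI exI[of _ 1]) simp
  then obtain u v where uv: "1 = u + v * f" "f * u \<in> I" "v \<in> polys K"
    unfolding comax[symmetric] unfolding ideal_sum_def colon_ideal_def ideal_gen_singleton[OF K]
    by blast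
  have "f * u = f * ((u + v * f) - v * f)" by simp
  also have "\<dots> = f - v * f\<^sup>2"
    unfolding uv(1)[symmetric] by (simp add: power2_eq_square algebra_simps)
  finally show ?thesis using that uv by simp
qed

text \<open>
  Here \<open>f\<close> is shown to lie in the quadratic module generated by the \<open>g\<^sub>i\<close> over the weighted sums of squares
  enlarged by \<open>I\<close>; afterwards every multiplier is diagonalised separately, and the errors made modulo \<open>I\<close>
  add up to an element of \<open>I\<close>.
\<close>

lemma sos_representation_exists:
  fixes g h :: "nat \<Rightarrow> 'n::finite mpoly"
  assumes K: "subfield_real K"
    and g: "\<forall>i\<in>{1..r}. g i \<in> polys K" and h: "\<forall>j\<in>{1..s}. h j \<in> polys K"
    and I: "I = ideal_gen K (h ` {1..s})"
    and basis: "monomial_basis K I B" and B: "finite B" "card B = D"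
    and f: "f \<in> polys K"
    and pos: "(\<forall>\<xi>\<in>semialg_set r s g h. eval f \<xi> > 0) \<or>
         ((\<forall>\<xi>\<in>semialg_set r s g h. eval f \<xi> \<ge> 0) \<and>
          ideal_sum (colon_ideal K I f) (ideal_gen K {f}) = ideal_gen K {1})"
  shows "\<exists>\<omega> q. (\<forall>i\<in>{0..r}. \<forall>k\<in>{1..D}. \<omega> i k \<in> nonneg_elems K \<and> q i k \<in> mono_span K B) \<and>
    f - (\<Sum>i=0..r. (\<Sum>k=1..D. const (\<omega> i k) * (q i k)\<^sup>2) * (g(0 := 1)) i) \<in> I"
proof -
  interpret subfield_algebra K const "polys K :: 'n mpoly set" by (rule polys_algebra[OF K])
  note Ih = ideal_gen_is_ideal[OF K, of "{1..s}" h, folded I]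
  have I_ideal: "ideal I" using Ih(1) h by blast
  note ID = idealD[OF I_ideal]
  define S where "S = {t + j | t j. t \<in> wsos (polys K) \<and> j \<in> I}"
  interpret preordered_algebra K const "polys K" S
    unfolding S_def by (rule preordered_algebra_wsos_plus_ideal[OF I_ideal])
  have IS: "I \<subseteq> S" unfolding S_def using wsos.zero by force
  have lin: "lin monom B = mono_span K B" using mono_span_eq_lin[OF K B(1)] by simp
  have monom_P: "monom m \<in> polys K" for m :: "'n monomial"
    using K_closed(1,2) by (simp add: polys_def lookup_single when_def)
  have span: "\<exists>q\<in>lin monom B. p - q \<in> I" if "p \<in> polys K" for p
    using basis that unfolding lin monomial_basis_def by blast
  interpret archimedean_algebra K const "polys K" S
    by unfold_locales (rule archimedean_if_finite_dim_mod_ideal[OF B(1) monom_P IS I_ideal span])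
  define G where "G = g(0 := 1)"
  have G: "G i \<in> polys K" if "i \<in> {0..r}" for i
    using that g P_one by (cases "i = 0") (auto simp: G_def)
  define M where "M = {\<Sum>i\<in>{0..r}. \<sigma> i * G i | \<sigma>. \<forall>i. \<sigma> i \<in> S}"
  have M: "quadratic_module M" and GM: "\<And>i. i \<in> {0..r} \<Longrightarrow> G i \<in> M"
    unfolding M_def
    by (rule quadratic_module_generated[of "{0..r}" 0 G]; use G in \<open>simp add: G_def\<close>)+
  have point: "\<exists>\<xi>\<in>semialg_set r s g h. \<phi> f = eval f \<xi>"
    if \<phi>: "real_character \<phi>" "\<And>a. a \<in> M \<Longrightarrow> \<phi> a \<ge> 0" for \<phi>
  proof -
    obtain \<xi> :: "real ^ 'n" where \<xi>: "\<And>p. p \<in> polys K \<Longrightarrow> \<phi> p = eval p \<xi>"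
      using real_character_polys_is_evaluation[OF K \<phi>(1)] by blast
    have "eval (g i) \<xi> \<ge> 0" if "i \<in> {1..r}" for i
      using \<phi>(2)[OF GM[of i]] that g \<xi> by (auto simp: G_def)
    moreover have "eval (h j) \<xi> = 0" if j: "j \<in> {1..s}" for j
    proof -
      have hI: "h j \<in> I" using Ih(2) h j by blast
      have "- 1 * h j \<in> I" by (intro ID(3) P_uminus P_one hI)
      then have "\<phi> (h j) \<ge> 0" "\<phi> (- h j) \<ge> 0"
        using hI IS \<phi>(2) quadratic_moduleD(5)[OF M] by auto
      then show ?thesis using real_characterD(4)[OF \<phi>(1), of "h j"] h j \<xi> by simp
    qed
    ultimately have "\<xi> \<in> semialg_set r s g h" by (simp add: semialg_set_def)
    then show ?thesis using \<xi>[OF f] by blast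
  qed
  have "f \<in> M"
    using pos
  proof
    assume p: "\<forall>\<xi>\<in>semialg_set r s g h. eval f \<xi> > 0"
    show ?thesis
    proof (rule archimedean_representation[OF M f])
      fix \<phi> assume "real_character \<phi>" "\<And>a. a \<in> M \<Longrightarrow> \<phi> a \<ge> 0"
      then obtain \<xi> where "\<xi> \<in> semialg_set r s g h" "\<phi> f = eval f \<xi>" using point by blast
      then show "\<phi> f > 0" using p by simp
    qed
  next
    assume nn: "(\<forall>\<xi>\<in>semialg_set r s g h. eval f \<xi> \<ge> 0) \<and>
          ideal_sum (colon_ideal K I f) (ideal_gen K {f}) = ideal_gen K {1}"
    then obtain v where v: "v \<in> polys K" "f - v * f\<^sup>2 \<in> I"
      using quasi_inverse_of_comaximal_colon[OF K I_ideal f] by blast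
    show ?thesis
    proof (rule archimedean_representation_nonneg[OF M IS I_ideal f v])
      fix \<phi> assume "real_character \<phi>" "\<And>a. a \<in> M \<Longrightarrow> \<phi> a \<ge> 0"
      then obtain \<xi> where "\<xi> \<in> semialg_set r s g h" "\<phi> f = eval f \<xi>" using point by blast
      then show "\<phi> f \<ge> 0" using nn by simp
    qed
  qed
  then obtain \<sigma> where \<sigma>: "f = (\<Sum>i\<in>{0..r}. \<sigma> i * G i)" "\<And>i. \<sigma> i \<in> S" unfolding M_def by blast
  obtain b where b: "bij_betw b {1..D} B" using ex_bij_betw_nat_finite_1[OF B(1)] B(2) by blast
  have "\<exists>w q. (\<forall>k\<in>{1..D}. w k \<in> nonneg_elems K \<and> q k \<in> mono_span K B) \<and>
      \<sigma> i - (\<Sum>k=1..D. const (w k) * (q k)\<^sup>2) \<in> I" for i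
  proof -
    obtain t j where t: "\<sigma> i = t + j" "t \<in> wsos (polys K)" "j \<in> I" using \<sigma>(2)[of i] unfolding S_def by blast
    obtain t' where t': "t' \<in> wsos (lin monom B)" "t - t' \<in> I"
      using wsos_reduce_mod_ideal[OF I_ideal _ span t(2)] lin_subset[of B monom] monom_P by blast
    obtain w q where wq: "\<forall>m\<in>B. w m \<in> nonneg_elems K \<and> q m \<in> lin monom B"
      "t' = (\<Sum>m\<in>B. const (w m) * (q m)\<^sup>2)" using wsos_lin_representation[OF B(1) t'(1)] by blast
    have "t' = (\<Sum>k=1..D. const (w (b k)) * (q (b k))\<^sup>2)"
      unfolding wq(2) by (rule sum.reindex_bij_betw[OF b, symmetric])
    moreover have "\<sigma> i - t' \<in> I" using ID(2)[OF t'(2) t(3)] by (simp add: t(1) algebra_simps)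
    ultimately show ?thesis using wq(1) bij_betwE[OF b] unfolding lin
      by (intro exI[of _ "\<lambda>k. w (b k)"] exI[of _ "\<lambda>k. q (b k)"]) auto
  qed
  then have "\<forall>i. \<exists>w q. (\<forall>k\<in>{1..D}. w k \<in> nonneg_elems K \<and> q k \<in> mono_span K B) \<and>
      \<sigma> i - (\<Sum>k=1..D. const (w k) * (q k)\<^sup>2) \<in> I" by (rule allI)
  from this[unfolded choice_iff] obtain \<omega> q where
    \<omega>: "\<And>i k. k \<in> {1..D} \<Longrightarrow> \<omega> i k \<in> nonneg_elems K \<and> q i k \<in> mono_span K B"
      "\<And>i. \<sigma> i - (\<Sum>k=1..D. const (\<omega> i k) * (q i k)\<^sup>2) \<in> I" by blast
  have "f - (\<Sum>i=0..r. (\<Sum>k=1..D. const (\<omega> i k) * (q i k)\<^sup>2) * G i) =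
      (\<Sum>i=0..r. G i * (\<sigma> i - (\<Sum>k=1..D. const (\<omega> i k) * (q i k)\<^sup>2)))"
    unfolding \<sigma>(1) by (simp add: sum_subtractf right_diff_distrib mult.commute)
  also have "\<dots> \<in> I" using \<omega>(2) G by (intro ID(5) ID(3))
  finally show ?thesis using \<omega>(1) unfolding G_def by blast
qed

text \<open>
  The remainder is bounded by the degrees of its individual terms, whatever cancellation takes place
  among them; this is what a graded basis needs as input.
\<close>

lemma deg_weighted_squares_le:
  assumes q: "\<And>i k. i \<in> {0..r} \<Longrightarrow> k \<in> {1..D} \<Longrightarrow> q i k \<in> mono_span K B"
    and d: "\<And>m. m \<in> B \<Longrightarrow> monomial_deg m \<le> d"
    and n: "deg f \<le> n" "\<And>i. i \<in> {0..r} \<Longrightarrow> deg (G i) + 2 * d \<le> n"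
  shows "deg (f - (\<Sum>i=0..r. (\<Sum>k=1..D. const (\<omega> i k) * (q i k)\<^sup>2) * G i)) \<le> n"
proof (intro deg_diff_le n(1) deg_sum_le)
  fix i assume i: "i \<in> {0..r}"
  have "deg (const (\<omega> i k) * (q i k)\<^sup>2) \<le> 0 + (d + d)" if "k \<in> {1..D}" for k
    unfolding power2_eq_square
    by (intro deg_mult_le deg_const deg_mono_span_le[OF q[OF i that]] d)
  then have "deg (\<Sum>k=1..D. const (\<omega> i k) * (q i k)\<^sup>2) \<le> d + d" by (intro deg_sum_le) simp
  from deg_mult_le[OF this order_refl, of "G i"]
  show "deg ((\<Sum>k=1..D. const (\<omega> i k) * (q i k)\<^sup>2) * G i) \<le> n"
    using n(2)[OF i] by simp
qed

theorem theorem1: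
  fixes K :: "real set"
    and r s D :: nat
    and g h :: "nat \<Rightarrow> 'n::finite mpoly"
    and I :: "'n mpoly set"
    and B :: "'n monomial set"
    and S :: "(real ^ 'n) set"
    and f :: "'n mpoly"
  assumes "subfield_real K"
    and "\<forall>i\<in>{1..r}. g i \<in> polys K"
    and "\<forall>j\<in>{1..s}. h j \<in> polys K"
    and "I = ideal_gen K (h ` {1..s})"
    and "zero_dimensional I"
    and "monomial_basis K I B"
    and "finite B" and "card B = D"
    and "S = semialg_set r s g h"
    and "f \<in> polys K"
    and "(\<forall>\<xi>\<in>S. eval f \<xi> > 0) \<or>
         ((\<forall>\<xi>\<in>S. eval f \<xi> \<ge> 0) \<and>
          ideal_sum (colon_ideal K I f) (ideal_gen K {f}) = ideal_gen K {1})"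
  shows "(\<exists>\<omega> q p. sos_representation K B D r s g h f \<omega> q p) \<and>
    (\<forall>d::nat. graded_basis K s h I \<longrightarrow> (\<forall>m\<in>B. monomial_deg m \<le> d) \<longrightarrow>
      (\<exists>\<omega> q p. sos_representation K B D r s g h f \<omega> q p \<and>
        (\<forall>j\<in>{1..s}. deg (p j * h j) \<le>
           Max ({deg f} \<union> {deg ((g(0 := 1)) i) + 2 * d | i. i \<in> {0..r}}))))"
proof -
  let ?G = "g(0 := 1)"
  obtain \<omega> q where \<omega>q: "\<forall>i\<in>{0..r}. \<forall>k\<in>{1..D}. \<omega> i k \<in> nonneg_elems K \<and> q i k \<in> mono_span K B"
    and R_I: "f - (\<Sum>i=0..r. (\<Sum>k=1..D. const (\<omega> i k) * (q i k)\<^sup>2) * ?G i) \<in> I"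
    using sos_representation_exists[OF assms(1-4,6-8,10) assms(11)[unfolded assms(9)]] by blast
  define R where "R = f - (\<Sum>i=0..r. (\<Sum>k=1..D. const (\<omega> i k) * (q i k)\<^sup>2) * ?G i)"
  have rest: "R \<in> I" using R_I by (simp only: R_def)
  have split: "f = X + (f - X')" if "X' = X" for X X' :: "'n mpoly"
    using that by simp
  have rep: "sos_representation K B D r s g h f \<omega> q p"
    if p: "\<forall>j\<in>{1..s}. p j \<in> polys K" "R = (\<Sum>j=1..s. p j * h j)" for p
  proof -
    have "(\<Sum>i=0..r. (\<Sum>k=1..D. const (\<omega> i k) * (q i k)\<^sup>2) * ?G i) =
        (\<Sum>k=1..D. const (\<omega> 0 k) * (q 0 k)\<^sup>2) + (\<Sum>i=1..r. (\<Sum>k=1..D. const (\<omega> i k) * (q i k)\<^sup>2) * g i)"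
      by (subst sum.atLeast_Suc_atMost) (auto intro!: sum.cong)
    then have "f = (\<Sum>k=1..D. const (\<omega> 0 k) * (q 0 k)\<^sup>2) +
        (\<Sum>i=1..r. (\<Sum>k=1..D. const (\<omega> i k) * (q i k)\<^sup>2) * g i) + R"
      unfolding R_def by (rule split)
    then show ?thesis
      unfolding p(2) sos_representation_def by (intro conjI \<omega>q p(1))
  qed
  obtain a where "R = (\<Sum>j=1..s. a j * h j)" "\<forall>j\<in>{1..s}. a j \<in> polys K"
    using rest unfolding assms(4) ideal_gen_eq_combinations[OF assms(1) finite_atLeastAtMost] by auto
  then have first: "sos_representation K B D r s g h f \<omega> q a" by (intro rep)
  have "\<exists>\<omega> q p. sos_representation K B D r s g h f \<omega> q p \<and>
        (\<forall>j\<in>{1..s}. deg (p j * h j) \<le> Max ({deg f} \<union> {deg (?G i) + 2 * d | i. i \<in> {0..r}}))"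
    if graded: "graded_basis K s h I" and d: "\<forall>m\<in>B. monomial_deg m \<le> d" for d
  proof -
    let ?n = "Max ({deg f} \<union> {deg (?G i) + 2 * d | i. i \<in> {0..r}})"
    have fin: "finite ({deg f} \<union> {deg (?G i) + 2 * d | i. i \<in> {0..r}})" by simp
    have "deg R \<le> ?n"
      unfolding R_def
    proof (rule deg_weighted_squares_le)
      show "q i k \<in> mono_span K B" if "i \<in> {0..r}" "k \<in> {1..D}" for i k using \<omega>q that by blast
      show "monomial_deg m \<le> d" if "m \<in> B" for m using d that by blast
      show "deg f \<le> ?n" by (rule Max_ge[OF fin]) simp
      show "deg (?G i) + 2 * d \<le> ?n" if "i \<in> {0..r}" for i
        by (rule Max_ge[OF fin]) (use that in blast)
    qed
    obtain a where a: "\<forall>j\<in>{1..s}. a j \<in> polys K" "R = (\<Sum>j=1..s. a j * h j)"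
      "\<forall>j\<in>{1..s}. a j = 0 \<or> h j = 0 \<or> deg (a j) + deg (h j) \<le> deg R"
      using bspec[OF graded[unfolded graded_basis_def] rest] by auto
    have "deg (a j * h j) \<le> ?n" if "j \<in> {1..s}" for j
    proof (cases "a j = 0 \<or> h j = 0")
      case True
      then show ?thesis by (auto simp: deg_def)
    next
      case False
      have "deg (a j * h j) \<le> deg (a j) + deg (h j)" by (rule deg_mult_le) auto
      also have "\<dots> \<le> deg R" using a(3) False that by blast
      finally show ?thesis using \<open>deg R \<le> ?n\<close> by linarith
    qed
    then show ?thesis using rep[OF a(1,2)] by blast
  qed
  then show ?thesis using first by blast
qed

end
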